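(* Fix $n\ge 2$ and $\alpha\in(0,n-1/3)$. Suppose that $E\subset\mathbb{R}^n$ is a bounded domain (open connected set) with boundary $\partial E$ of class - $C^1$ if $\alpha<n-1$; - $C^{1,\gamma}$ for some $\gamma\in(0,1]$ with $1+\gamma>1/(n-\alpha)$ if $\alpha\in[n-1,n-1/2)$; - $C^{2,\gamma}$ for some $\gamma\in(0,1]$ with $2+\gamma>1/(n-\alpha)$ if $\alpha\in[n-1/2,n-1/3)$. Let $v_E(x)=\int_E\frac{dy}{|x-y|^\alpha}$ for $x\in\mathbb{R}^n$. If $v_E$ is constant on $\partial E$, then $E$ is a ball.
   Context: All notions are standard: $v_E$ is the Riesz potential of $E$, and a boundary of class $C^{k,\gamma}$ means that $E$ is locally the subgraph of a $C^{k,\gamma}$ function in suitable orthonormal coordinates near each boundary point. "Constant on $\partial E$" means that the same constant value is taken on all of $\partial E$. *)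

theory Defs
  imports "HOL-Analysis.Analysis"
begin

text \<open>The integrand takes the value \<open>0\<close> at \<open>y = x\<close>, because \<open>1 / 0 = 0\<close>; this concerns a single
  point and does not affect the integral.\<close>

definition riesz_potential :: "real \<Rightarrow> (real^'n) set \<Rightarrow> real^'n \<Rightarrow> real" where
  "riesz_potential \<alpha> E x = (LINT y:E|lebesgue. 1 / norm (x - y) powr \<alpha>)"

definition holder_on :: "real \<Rightarrow> 'a::metric_space set \<Rightarrow> ('a \<Rightarrow> real) \<Rightarrow> bool" where
  "holder_on \<gamma> U f \<longleftrightarrow> (\<exists>C. \<forall>x\<in>U. \<forall>y\<in>U. \<bar>f x - f y\<bar> \<le> C * dist x y powr \<gamma>)"

text \<open>\<open>C_class P k U f\<close>: on the open set \<open>U\<close>, the function \<open>f\<close> and all its iterated partial derivatives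
  of order less than \<open>k\<close> are differentiable, and all partial derivatives of order exactly \<open>k\<close>
  satisfy \<open>P U\<close>.\<close>

primrec C_class ::
    "('a::euclidean_space set \<Rightarrow> ('a \<Rightarrow> real) \<Rightarrow> bool) \<Rightarrow> nat \<Rightarrow> 'a set \<Rightarrow> ('a \<Rightarrow> real) \<Rightarrow> bool" where
  "C_class P 0 U f \<longleftrightarrow> P U f"
| "C_class P (Suc k) U f \<longleftrightarrow>
     (\<forall>x\<in>U. f differentiable (at x)) \<and>
     (\<forall>b\<in>Basis. C_class P k U (\<lambda>x. frechet_derivative f (at x) b))"

definition Ck_on :: "nat \<Rightarrow> 'a::euclidean_space set \<Rightarrow> ('a \<Rightarrow> real) \<Rightarrow> bool" where
  "Ck_on k = C_class continuous_on k"

definition Ck_holder_on :: "nat \<Rightarrow> real \<Rightarrow> 'a::euclidean_space set \<Rightarrow> ('a \<Rightarrow> real) \<Rightarrow> bool" where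
  "Ck_holder_on k \<gamma> = C_class (holder_on \<gamma>) k"

text \<open>The map \<open>x \<mapsto> T (x - p)\<close> gives orthonormal coordinates centred at the boundary point \<open>p\<close>, and the
  \<open>i\<close>-th one is the graph direction. A function of the remaining \<open>n - 1\<close> coordinates is encoded as
  a function \<open>\<phi>\<close> on the whole space that does not depend on the \<open>i\<close>-th coordinate. For such \<open>\<phi>\<close>, being
  of class \<open>C\<^sup>k\<close> or \<open>C\<^sup>k\<^sup>,\<^sup>\<gamma>\<close> on the \<open>n\<close>-dimensional ball \<open>ball 0 r\<close> is the same as being so on the
  \<open>(n - 1)\<close>-dimensional ball of radius \<open>r\<close>. The predicate \<open>R\<close> is the regularity class.\<close>

definition boundary_of_class ::
    "((real^'n) set \<Rightarrow> (real^'n \<Rightarrow> real) \<Rightarrow> bool) \<Rightarrow> (real^'n) set \<Rightarrow> bool" where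
  "boundary_of_class R E \<longleftrightarrow>
     (\<forall>p\<in>frontier E. \<exists>T i r \<phi>.
        orthogonal_transformation T \<and> 0 < r \<and>
        (\<forall>y z. (\<forall>j. j \<noteq> i \<longrightarrow> y $ j = z $ j) \<longrightarrow> \<phi> y = \<phi> z) \<and>
        R (ball 0 r) \<phi> \<and>
        E \<inter> ball p r = {x \<in> ball p r. T (x - p) $ i < \<phi> (T (x - p))})"

end

theory Submission
  imports Defs
begin

text \<open>The proof is by moving planes. Fix a unit vector \<open>e\<close> and push the hyperplane \<open>{y. y \<bullet> e = l}\<close> from
\<open>l = \<infinity>\<close> downwards. As long as the part of \<open>E\<close> beyond the hyperplane is reflected into \<open>E\<close>, the plane
may go on; let \<open>L\<close> be the critical position. There, either the reflected cap touches \<open>\<partial>E\<close> from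
inside at a point off the hyperplane, or the hyperplane meets \<open>\<partial>E\<close> at a point \<open>p\<close> where \<open>e\<close> is
tangent to \<open>\<partial>E\<close>.

The analytic part rests on two bounds for the potential \<open>u\<close>. Write \<open>x*\<close> for the mirror image of \<open>x\<close>.
If \<open>E\<close> is not symmetric about the critical hyperplane, then the reflected cap misses a ball of \<open>E\<close>, and
the kernel is strictly larger on the near side, so that \<open>u x - u x* \<ge> c \<tau>\<close> for \<open>x\<close> at distance
\<open>\<tau>\<close> in front of the hyperplane (\<open>riesz_potential_reflect_gap\<close>). On the other hand, \<open>u\<close> is Hoelder
continuous with every exponent \<open>\<beta> \<le> 1\<close> such that \<open>\<alpha> + \<beta> < n\<close> (\<open>riesz_potential_holder\<close>). Hence
\<open>E\<close> must be symmetric as soon as there are boundary points \<open>x\<close>, \<open>x'\<close> with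
\<open>\<bar>x* - x'\<bar>\<^sup>\<beta> \<le> \<epsilon> \<tau>\<close> for arbitrarily small \<open>\<epsilon>\<close>, because \<open>u x = u x'\<close>: this is
\<open>symmetric_of_fold_touching\<close>, and \<open>fold_touching\<close> is the name of this condition.

At an interior touching point the condition holds trivially with \<open>x' = x*\<close>. At a tangency point \<open>p\<close>
it is a matter of the regularity of \<open>\<partial>E\<close>. Move from \<open>p\<close> by \<open>- t e\<close>, correct to a boundary point
\<open>x\<close>, reflect, and correct again to a boundary point \<open>x'\<close>. The last correction is the odd part of a
defining function of \<open>E\<close> in the direction \<open>e\<close>, whose first derivative vanishes at \<open>p\<close>. It is
\<open>o(t)\<close> for a \<open>C\<^sup>1\<close> boundary, \<open>O(t\<^bsup>1+\<gamma>\<^esup>)\<close> for a \<open>C\<^bsup>1,\<gamma>\<^esup>\<close> boundary, and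
\<open>O(t\<^bsup>2+\<gamma>\<^esup>)\<close> for a \<open>C\<^bsup>2,\<gamma>\<^esup>\<close> boundary, since the second-order term is even and cancels. The
relation between \<open>\<gamma>\<close> and \<open>\<alpha>\<close> says exactly that an admissible \<open>\<beta>\<close> makes the \<open>\<beta>\<close>-th power of this
\<open>o(t)\<close>; in the \<open>C\<^sup>1\<close> case \<open>\<beta> = 1\<close> is admissible.

So \<open>E\<close> has a symmetry hyperplane orthogonal to each direction, which passes through the centroid
\<open>c\<close>. For every hyperplane strictly beyond \<open>c\<close> the cap folds into \<open>E\<close>, and as any point \<open>x\<close> can be
folded in this way onto any point closer to \<open>c\<close>, the set \<open>E\<close> is a ball.\<close>

section \<open>Reflections in hyperplanes\<close>

definition reflect :: "'a::euclidean_space \<Rightarrow> real \<Rightarrow> 'a \<Rightarrow> 'a" where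
  "reflect e l x = x - (2 * (x \<bullet> e - l)) *\<^sub>R e"

lemma reflect_inner:
  assumes "norm e = 1"
  shows "reflect e l x \<bullet> e = 2 * l - x \<bullet> e"
  using assms by (simp add: reflect_def inner_diff_left norm_eq_1)

lemma reflect_reflect [simp]:
  assumes "norm e = 1"
  shows "reflect e l (reflect e l x) = x"
proof -
  have "reflect e l (reflect e l x) = x - (2 * (x \<bullet> e - l) + 2 * (l - x \<bullet> e)) *\<^sub>R e"
    unfolding reflect_def[of e l "reflect e l x"] reflect_inner[OF assms]
    by (simp add: reflect_def algebra_simps)
  then show ?thesis by simp
qed

lemma reflect_on_plane: "x \<bullet> e = l \<Longrightarrow> reflect e l x = x"
  by (simp add: reflect_def)

text \<open>This identity governs all comparisons of distances to a point and to its mirror image: the sign of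
  the last summand tells whether \<open>x\<close> and \<open>y\<close> lie on the same side of the hyperplane.\<close>

lemma norm_reflect_diff_eq:
  assumes "norm e = 1"
  shows "(norm (reflect e l x - y))\<^sup>2 = (norm (x - y))\<^sup>2 + 4 * (l - x \<bullet> e) * (l - y \<bullet> e)"
proof -
  define s where "s = 2 * (x \<bullet> e - l)"
  have "(norm (reflect e l x - y))\<^sup>2 = (norm ((x - y) - s *\<^sub>R e))\<^sup>2"
    by (simp add: reflect_def s_def algebra_simps)
  also have "\<dots> = (norm (x - y))\<^sup>2 - 2 * s * ((x - y) \<bullet> e) + s\<^sup>2 * (e \<bullet> e)"
    unfolding power2_norm_eq_inner
    by (simp add: inner_diff_left inner_diff_right inner_commute power2_eq_square algebra_simps)
  finally show ?thesis using assms
    by (simp add: norm_eq_1 s_def inner_diff_left algebra_simps power2_eq_square)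
qed

lemma norm_reflect_reflect:
  assumes "norm e = 1"
  shows "norm (reflect e l x - reflect e l y) = norm (x - y)"
proof -
  have "(norm (reflect e l x - reflect e l y))\<^sup>2 = (norm (x - y))\<^sup>2"
    using norm_reflect_diff_eq[OF assms, of l x "reflect e l y"]
      norm_reflect_diff_eq[OF assms, of l y x] reflect_inner[OF assms, of l y]
    by (simp add: norm_minus_commute algebra_simps)
  then show ?thesis by simp
qed

lemma norm_reflect_swap:
  assumes "norm e = 1"
  shows "norm (reflect e l x - y) = norm (x - reflect e l y)"
  using norm_reflect_reflect[OF assms, of l x "reflect e l y"] assms by simp

lemma continuous_on_reflect [continuous_intros]: "continuous_on S (reflect e l)"
  unfolding reflect_def by (intro continuous_intros)

lemma measurable_reflect [measurable]: "reflect e l \<in> borel_measurable borel"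
  by (intro borel_measurable_continuous_onI continuous_on_reflect)

lemma reflect_image_eq_vimage:
  assumes "norm e = 1"
  shows "reflect e l ` A = reflect e l -` A"
  using assms by (auto intro!: image_eqI[of _ _ "reflect e l _"])

lemma open_reflect_image:
  assumes "norm e = 1" "open A"
  shows "open (reflect e l ` A)"
  unfolding reflect_image_eq_vimage[OF assms(1)]
  using assms(2) continuous_on_reflect by (rule open_vimage)

lemma reflect_ball:
  assumes "norm e = 1"
  shows "reflect e l ` ball a r = ball (reflect e l a) r"
  unfolding reflect_image_eq_vimage[OF assms]
  using norm_reflect_swap[OF assms, of l a] by (auto simp: dist_norm)

text \<open>An isometry preserves the volume of balls, and by Vitali's covering theorem an open set is, up to a
  null set, a disjoint union of balls. Only an inequality is claimed, so that nothing has to be known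
  about the image of the exceptional null set; applying it to the image gives the converse.\<close>

lemma emeasure_open_le_reflect:
  fixes e :: "'a::euclidean_space"
  assumes e: "norm e = 1" and U: "open U"
  shows "emeasure lborel U \<le> emeasure lborel (reflect e l ` U)"
proof -
  define K where "K = {(a::'a, r::real). 0 < r \<and> ball a r \<subseteq> U}"
  have "\<exists>i. i \<in> K \<and> x \<in> ball (fst i) (snd i) \<and> snd i < d" if "x \<in> U" "0 < d" for x d
  proof -
    obtain r where "r > 0" "ball x r \<subseteq> U"
      using U \<open>x \<in> U\<close> by (auto simp: open_contains_ball)
    then show ?thesis using that
      by (intro exI[of _ "(x, min r (d/2))"]) (auto simp: K_def)
  qed
  then obtain C where C: "countable C" "C \<subseteq> K"
      "pairwise (\<lambda>i j. disjnt (ball (fst i) (snd i)) (ball (fst j) (snd j))) C"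
      "negligible (U - (\<Union>i\<in>C. ball (fst i) (snd i)))"
    by (rule Vitali_covering_theorem_balls) blast
  define B where "B i = ball (fst i :: 'a) (snd i)" for i
  have sub: "B i \<subseteq> U" if "i \<in> C" for i
    using C(2) that by (cases i) (auto simp: B_def K_def)
  have disj: "disjoint_family_on B C"
    using C(3) by (auto simp: disjoint_family_on_def pairwise_def disjnt_def B_def)
  have mB: "B i \<in> sets lborel" "open (B i)" for i by (auto simp: B_def)
  have N: "U - (\<Union>i\<in>C. B i) \<in> null_sets lborel"
  proof -
    have "U - (\<Union>i\<in>C. B i) \<in> sets lborel"
      using U mB(2) open_UN[of C B] by (simp add: sets.Diff)
    then show ?thesis
      using C(4) by (simp add: B_def negligible_iff_null_sets null_sets_completion_iff)
  qed
  have "U = (\<Union>i\<in>C. B i) \<union> (U - (\<Union>i\<in>C. B i))" using sub by blast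
  then have "emeasure lborel U = emeasure lborel (\<Union>i\<in>C. B i)"
    using N mB C(1) by (metis emeasure_Un_null_set sets.countable_UN'')
  also have "\<dots> = (\<integral>\<^sup>+i. emeasure lborel (B i) \<partial>count_space C)"
    using C(1) disj mB by (intro emeasure_UN_countable) auto
  also have "\<dots> = (\<integral>\<^sup>+i. emeasure lborel (reflect e l ` B i) \<partial>count_space C)"
  proof (rule nn_integral_cong)
    fix i assume "i \<in> space (count_space C)"
    then have "0 \<le> snd i" using C(2) by (auto simp: K_def)
    then show "emeasure lborel (B i) = emeasure lborel (reflect e l ` B i)"
      by (simp add: B_def reflect_ball[OF e] emeasure_ball)
  qed
  also have "\<dots> = emeasure lborel (\<Union>i\<in>C. reflect e l ` B i)"
  proof (rule emeasure_UN_countable[symmetric])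
    show "disjoint_family_on (\<lambda>i. reflect e l ` B i) C"
      using disj unfolding reflect_image_eq_vimage[OF e] disjoint_family_on_def by blast
  qed (use C(1) open_reflect_image[OF e mB(2)] in auto)
  also have "\<dots> \<le> emeasure lborel (reflect e l ` U)"
    using sub open_reflect_image[OF e U] by (intro emeasure_mono) auto
  finally show ?thesis .
qed

lemma distr_lborel_reflect:
  fixes e :: "'a::euclidean_space"
  assumes e: "norm e = 1"
  shows "distr lborel borel (reflect e l) = lborel"
proof (rule sym, rule lborel_eqI)
  fix a b :: 'a assume le: "\<And>i. i \<in> Basis \<Longrightarrow> a \<bullet> i \<le> b \<bullet> i"
  have "emeasure lborel (reflect e l ` box a b) = emeasure lborel (box a b)"
    using emeasure_open_le_reflect[OF e open_box, of a b l]
      emeasure_open_le_reflect[OF e open_reflect_image[OF e open_box], of l a b l]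
      e by (simp add: image_comp o_def)
  then show "emeasure (distr lborel borel (reflect e l)) (box a b) = (\<Prod>i\<in>Basis. (b - a) \<bullet> i)"
    using le by (simp add: emeasure_distr reflect_image_eq_vimage[OF e] emeasure_lborel_box)
qed simp

lemma integral_lborel_reflect:
  fixes e :: "'a::euclidean_space" and f :: "'a \<Rightarrow> real"
  assumes "norm e = 1" "f \<in> borel_measurable borel"
  shows "(\<integral>y. f (reflect e l y) \<partial>lborel) = (\<integral>y. f y \<partial>lborel)"
  using assms integral_distr[of "reflect e l" lborel borel f]
  by (simp add: distr_lborel_reflect)

lemma integrable_lborel_reflect:
  fixes e :: "'a::euclidean_space" and f :: "'a \<Rightarrow> real"
  assumes "norm e = 1" "integrable lborel f"
  shows "integrable lborel (\<lambda>y. f (reflect e l y))"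
  using assms integrable_distr[of "reflect e l" lborel borel f]
  by (simp add: distr_lborel_reflect)

section \<open>Riesz potentials of bounded sets\<close>

text \<open>The left-hand side is at most \<open>1\<close> and at most \<open>\<alpha> * (r - 1)\<close>, and \<open>min 1 (r - 1)\<close> is at most
  \<open>(r - 1) powr \<beta>\<close>.\<close>

lemma one_minus_powr_le:
  fixes r \<alpha> \<beta> :: real
  assumes "1 \<le> r" "0 < \<alpha>" "0 < \<beta>" "\<beta> \<le> 1"
  shows "1 - r powr - \<alpha> \<le> max 1 \<alpha> * (r - 1) powr \<beta>"
proof (cases "r \<ge> 2")
  case True
  then have "1 \<le> (r - 1) powr \<beta>" using assms by (intro ge_one_powr_ge_zero) auto
  moreover have "1 * (r - 1) powr \<beta> \<le> max 1 \<alpha> * (r - 1) powr \<beta>"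
    by (intro mult_right_mono) auto
  moreover have "r powr - \<alpha> \<ge> 0" by simp
  ultimately show ?thesis by linarith
next
  case False
  have "r powr - \<alpha> = exp (- \<alpha> * ln r)" using assms by (simp add: powr_def)
  also have "\<dots> \<ge> 1 + (- \<alpha> * ln r)" by (rule exp_ge_add_one_self)
  also have "1 + (- \<alpha> * ln r) \<ge> 1 - \<alpha> * (r - 1)"
    using ln_le_minus_one[of r] assms by simp
  finally have "1 - r powr - \<alpha> \<le> \<alpha> * (r - 1)" by simp
  also have "r - 1 \<le> (r - 1) powr \<beta>"
    using False assms powr_mono'[of \<beta> 1 "r - 1"] by (cases "r = 1") auto
  then have "\<alpha> * (r - 1) \<le> \<alpha> * (r - 1) powr \<beta>" using assms by simp
  also have "\<dots> \<le> max 1 \<alpha> * (r - 1) powr \<beta>"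
    by (intro mult_right_mono) auto
  finally show ?thesis .
qed

lemma powr_minus_diff_le_ordered:
  fixes a b \<alpha> \<beta> :: real
  assumes "0 < a" "a \<le> b" "0 < \<alpha>" "0 < \<beta>" "\<beta> \<le> 1"
  shows "a powr - \<alpha> - b powr - \<alpha> \<le> max 1 \<alpha> * (b - a) powr \<beta> * a powr - (\<alpha> + \<beta>)"
proof -
  have "a powr - \<alpha> - b powr - \<alpha> = a powr - \<alpha> * (1 - (b / a) powr - \<alpha>)"
    using assms by (simp add: powr_divide right_diff_distrib)
  also have "\<dots> \<le> a powr - \<alpha> * (max 1 \<alpha> * (b / a - 1) powr \<beta>)"
    using assms by (intro mult_left_mono one_minus_powr_le) auto
  also have "b / a - 1 = (b - a) / a" using assms by (simp add: field_simps)
  also have "a powr - \<alpha> * (max 1 \<alpha> * ((b - a) / a) powr \<beta>) =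
      max 1 \<alpha> * (b - a) powr \<beta> * a powr - (\<alpha> + \<beta>)"
    using assms powr_add[of a "- \<alpha>" "- \<beta>"] by (simp add: powr_divide powr_minus_divide[of a \<beta>])
  finally show ?thesis .
qed

text \<open>A Hoelder estimate for the Riesz kernel: one pays for the exponent \<open>\<beta>\<close> by a kernel of order
  \<open>\<alpha> + \<beta>\<close>, which is still locally integrable when \<open>\<alpha> + \<beta>\<close> is less than the dimension.\<close>

lemma powr_minus_diff_le:
  fixes a b \<alpha> \<beta> :: real
  assumes "0 < a" "0 < b" "0 < \<alpha>" "0 < \<beta>" "\<beta> \<le> 1"
  shows "\<bar>a powr - \<alpha> - b powr - \<alpha>\<bar>
    \<le> max 1 \<alpha> * \<bar>a - b\<bar> powr \<beta> * (a powr - (\<alpha> + \<beta>) + b powr - (\<alpha> + \<beta>))"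
proof -
  have *: "\<bar>a powr - \<alpha> - b powr - \<alpha>\<bar>
    \<le> max 1 \<alpha> * \<bar>a - b\<bar> powr \<beta> * (a powr - (\<alpha> + \<beta>) + b powr - (\<alpha> + \<beta>))"
    if "0 < a" "a \<le> b" for a b
  proof -
    have "b powr - \<alpha> \<le> a powr - \<alpha>"
      using that assms by (intro powr_mono2') auto
    then have "\<bar>a powr - \<alpha> - b powr - \<alpha>\<bar> = a powr - \<alpha> - b powr - \<alpha>" by simp
    also have "\<dots> \<le> max 1 \<alpha> * (b - a) powr \<beta> * a powr - (\<alpha> + \<beta>)"
      using that assms by (intro powr_minus_diff_le_ordered) auto
    also have "\<dots> \<le> max 1 \<alpha> * (b - a) powr \<beta> * (a powr - (\<alpha> + \<beta>) + b powr - (\<alpha> + \<beta>))"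
      by (intro mult_left_mono) auto
    finally show ?thesis using that by simp
  qed
  show ?thesis
  proof (cases "a \<le> b")
    case True
    then show ?thesis using * assms by blast
  next
    case False
    then show ?thesis using *[of b a] assms by (simp add: abs_minus_commute add.commute)
  qed
qed

text \<open>Sum over dyadic balls: where \<open>2\<^bsup>-k-1\<^esup> \<le> \<bar>x - y\<bar> < 2\<^sup>-\<^sup>k\<close>, the kernel is at most \<open>2\<^bsup>(k+1)s\<^esup>\<close>, and
  the ball of radius \<open>2\<^sup>-\<^sup>k\<close> has volume proportional to \<open>2\<^bsup>-kn\<^esup>\<close>. The resulting geometric series has
  ratio \<open>2\<^bsup>s-n\<^esup> < 1\<close> and does not depend on \<open>x\<close>.\<close>

lemma nn_integral_norm_powr_unit_ball:
  assumes s: "0 < s" "s < real DIM('a::euclidean_space)"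
  obtains M :: real where "\<And>x::'a.
    (\<integral>\<^sup>+y. ennreal (norm (x - y) powr - s) * indicator (ball x 1) y \<partial>lborel) \<le> ennreal M"
proof -
  define n where "n = DIM('a)"
  define V where "V = unit_ball_vol (real n)"
  define q where "q = 2 powr s * (1/2) ^ n"
  have q: "0 < q" "q < 1"
  proof -
    have "2 powr s < 2 powr real n" using s by (simp add: n_def)
    then have "2 powr s < 2 ^ n" by (simp add: powr_realpow)
    then show "q < 1" by (simp add: q_def power_one_over field_simps)
    show "0 < q" by (simp add: q_def)
  qed
  have V: "0 \<le> V" by (simp add: V_def)
  have "(\<integral>\<^sup>+y. ennreal (norm (x - y) powr - s) * indicator (ball x 1) y \<partial>lborel)
      \<le> ennreal (2 powr s * V * (1 / (1 - q)))" for x :: 'a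
  proof -
    define g where "g k y = ennreal (2 powr s * (2 powr s) ^ k) * indicator (ball x ((1/2) ^ k)) y"
      for k and y :: 'a
    have le: "ennreal (norm (x - y) powr - s) * indicator (ball x 1) y \<le> (\<Sum>k. g k y)" for y
    proof (cases "y \<in> ball x 1 \<and> y \<noteq> x")
      case True
      define d where "d = norm (x - y)"
      have d: "0 < d" "d < 1" using True by (auto simp: d_def dist_norm)
      \<comment> \<open>The index of the dyadic shell about \<open>x\<close> that contains \<open>y\<close>.\<close>
      define k where "k = (LEAST k. (1/2) ^ Suc k \<le> d)"
      obtain m where "(1/2) ^ m < d" using real_arch_pow_inv[of d "1/2"] d by auto
      then have "(1/2) ^ Suc m \<le> d" using d by simp
      then have k: "(1/2) ^ Suc k \<le> d" unfolding k_def by (rule LeastI)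
      have "d < (1/2) ^ k"
      proof (cases k)
        case (Suc j)
        then have "\<not> (1/2) ^ Suc j \<le> d" using not_less_Least[of j "\<lambda>k. (1/2) ^ Suc k \<le> d"]
          by (simp add: k_def)
        then show ?thesis using Suc by simp
      qed (use d in simp)
      then have ind: "y \<in> ball x ((1/2) ^ k)" by (simp add: d_def dist_norm)
      have pow: "(h ^ j) powr - s = (h powr - s) ^ j" if "0 < h" for h :: real and j
      proof (induction j)
        case (Suc j)
        have "(h * h ^ j) powr - s = h powr - s * (h ^ j) powr - s"
          using that by (intro powr_mult)
        then show ?case using Suc by simp
      qed (use that in simp)
      have "d powr - s \<le> ((1/2) ^ Suc k) powr - s"
        using k d s by (intro powr_mono2') auto
      also have "\<dots> = ((1/2) powr - s) ^ Suc k" by (rule pow) simp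
      also have "(1/2) powr - s = 2 powr s" by (simp add: powr_minus powr_divide)
      finally have "ennreal (d powr - s) \<le> g k y"
        using ind by (simp add: g_def ennreal_leI)
      also have "\<dots> \<le> (\<Sum>k. g k y)"
        using sum_le_suminf[of "\<lambda>k. g k y" "{k}"] by simp
      finally show ?thesis using True by (simp add: d_def)
    qed auto
    have "(\<integral>\<^sup>+y. ennreal (norm (x - y) powr - s) * indicator (ball x 1) y \<partial>lborel)
        \<le> (\<integral>\<^sup>+y. (\<Sum>k. g k y) \<partial>lborel)"
      by (intro nn_integral_mono le)
    also have "\<dots> = (\<Sum>k. \<integral>\<^sup>+y. g k y \<partial>lborel)"
      unfolding g_def by (intro nn_integral_suminf borel_measurable_times_ennreal
          borel_measurable_const borel_measurable_indicator) simp
    also have "(\<lambda>k. \<integral>\<^sup>+y. g k y \<partial>lborel) = (\<lambda>k. ennreal (2 powr s * V * q ^ k))"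
    proof
      fix k
      have "(\<integral>\<^sup>+y. g k y \<partial>lborel) =
          ennreal (2 powr s * (2 powr s) ^ k) * emeasure lborel (ball x ((1/2) ^ k))"
        unfolding g_def by (intro nn_integral_cmult_indicator) simp
      also have "emeasure lborel (ball x ((1/2) ^ k)) = ennreal (V * ((1/2) ^ k) ^ n)"
        by (simp add: emeasure_ball V_def n_def)
      also have "ennreal (2 powr s * (2 powr s) ^ k) * \<dots> =
          ennreal (2 powr s * (2 powr s) ^ k * (V * ((1/2) ^ k) ^ n))"
        using V by (intro ennreal_mult[symmetric]) auto
      also have "((1/2::real) ^ k) ^ n = ((1/2) ^ n) ^ k"
        by (metis power_mult mult.commute)
      also have "2 powr s * (2 powr s) ^ k * (V * ((1/2) ^ n) ^ k) = 2 powr s * V * q ^ k"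
        unfolding q_def power_mult_distrib by (simp only: mult_ac)
      finally show "(\<integral>\<^sup>+y. g k y \<partial>lborel) = ennreal (2 powr s * V * q ^ k)" .
    qed
    also have "(\<Sum>k. ennreal (2 powr s * V * q ^ k)) = ennreal (2 powr s * V * (1 / (1 - q)))"
      using q V by (intro suminf_ennreal_eq sums_mult geometric_sums) auto
    finally show ?thesis .
  qed
  then show thesis by (rule that)
qed

text \<open>Outside the unit ball about \<open>x\<close> the kernel is at most \<open>1\<close>, so there the volume of \<open>E\<close> is a bound.\<close>

lemma integrable_norm_powr_uniform:
  fixes E :: "'a::euclidean_space set"
  assumes s: "0 < s" "s < real DIM('a)" and E: "bounded E" "E \<in> sets borel"
  obtains M :: real where
    "\<And>x. integrable lborel (\<lambda>y. indicator E y * norm (x - y) powr - s)"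
    "\<And>x. (\<integral>y. indicator E y * norm (x - y) powr - s \<partial>lborel) \<le> M"
proof -
  obtain M :: real where M: "\<And>x::'a.
      (\<integral>\<^sup>+y. ennreal (norm (x - y) powr - s) * indicator (ball x 1) y \<partial>lborel) \<le> ennreal M"
    using nn_integral_norm_powr_unit_ball[OF s] by blast
  define m where "m = measure lborel E"
  have m: "emeasure lborel E = ennreal m"
    using emeasure_bounded_finite[OF E(1)] by (simp add: m_def emeasure_eq_ennreal_measure)
  have [measurable]: "E \<in> sets borel" by (rule E)
  have [measurable]: "(\<lambda>y. norm (x - y) powr - s) \<in> borel_measurable borel" for x :: 'a
    by measurable
  have [measurable]: "ball x 1 \<in> sets borel" for x :: 'a by simp
  have bd: "(\<integral>\<^sup>+y. ennreal (indicator E y * norm (x - y) powr - s) \<partial>lborel) \<le> ennreal (max 0 M + m)"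
    for x
  proof -
    have "ennreal (indicator E y * norm (x - y) powr - s)
        \<le> ennreal (norm (x - y) powr - s) * indicator (ball x 1) y + indicator E y" for y
    proof (cases "y \<in> ball x 1")
      case False
      then have "norm (x - y) powr - s \<le> 1 powr - s"
        using s by (intro powr_mono2') (auto simp: dist_norm)
      then show ?thesis using False by (auto simp: indicator_def)
    qed (auto simp: indicator_def)
    then have "(\<integral>\<^sup>+y. ennreal (indicator E y * norm (x - y) powr - s) \<partial>lborel)
        \<le> (\<integral>\<^sup>+y. ennreal (norm (x - y) powr - s) * indicator (ball x 1) y + indicator E y \<partial>lborel)"
      by (intro nn_integral_mono)
    also have "\<dots> = (\<integral>\<^sup>+y. ennreal (norm (x - y) powr - s) * indicator (ball x 1) y \<partial>lborel) + ennreal m"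
      by (subst nn_integral_add) (simp_all add: m)
    also have "\<dots> \<le> ennreal (max 0 M) + ennreal m"
      by (intro add_mono order_trans[OF M]) (auto intro: ennreal_leI)
    finally show ?thesis by (simp add: m_def ennreal_plus)
  qed
  have int: "integrable lborel (\<lambda>y. indicator E y * norm (x - y) powr - s)" for x
    using bd[of x] by (intro integrableI_nonneg) (auto intro: le_less_trans)
  moreover have "(\<integral>y. indicator E y * norm (x - y) powr - s \<partial>lborel) \<le> max 0 M + m" for x
  proof -
    have eq: "(\<integral>\<^sup>+y. ennreal (indicator E y * norm (x - y) powr - s) \<partial>lborel)
        = ennreal (\<integral>y. indicator E y * norm (x - y) powr - s \<partial>lborel)"
      by (intro nn_integral_eq_integral[OF int] AE_I2) simp
    have "0 \<le> max 0 M + m" by (simp add: m_def)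
    then show ?thesis using bd[of x] unfolding eq by (rule iffD1[OF ennreal_le_iff])
  qed
  ultimately show thesis by (rule that)
qed

lemma riesz_potential_eq:
  assumes "E \<in> sets borel"
  shows "riesz_potential \<alpha> E x = (\<integral>y. indicator E y * norm (x - y) powr - \<alpha> \<partial>lborel)"
proof -
  have [measurable]: "E \<in> sets borel" by (rule assms)
  show ?thesis
    by (simp add: riesz_potential_def set_lebesgue_integral_def integral_completion powr_minus_divide)
qed

lemma riesz_potential_holder:
  fixes E :: "(real^'n) set"
  assumes E: "bounded E" "E \<in> sets borel"
    and \<alpha>: "0 < \<alpha>" and \<beta>: "0 < \<beta>" "\<beta> \<le> 1" "\<alpha> + \<beta> < real CARD('n)"
  obtains C where "0 \<le> C"
    "\<And>x z. \<bar>riesz_potential \<alpha> E x - riesz_potential \<alpha> E z\<bar> \<le> C * norm (x - z) powr \<beta>"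
proof -
  obtain M where M: "\<And>x. integrable lborel (\<lambda>y. indicator E y * norm (x - y) powr - (\<alpha> + \<beta>))"
    "\<And>x. (\<integral>y. indicator E y * norm (x - y) powr - (\<alpha> + \<beta>) \<partial>lborel) \<le> M"
    using integrable_norm_powr_uniform[of "\<alpha> + \<beta>" E] assms by auto
  obtain M' where M': "\<And>x. integrable lborel (\<lambda>y. indicator E y * norm (x - y) powr - \<alpha>)"
    using integrable_norm_powr_uniform[of \<alpha> E] assms by auto
  define L where "L = max 1 \<alpha>"
  have "\<bar>riesz_potential \<alpha> E x - riesz_potential \<alpha> E z\<bar> \<le> (L * (2 * max 0 M)) * norm (x - z) powr \<beta>"
    for x z
  proof -
    let ?f = "\<lambda>s x y. indicator E y * norm (x - y) powr - s :: real"
    define c where "c = L * norm (x - z) powr \<beta>"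
    have c: "0 \<le> c" by (simp add: c_def L_def)
    have "\<bar>riesz_potential \<alpha> E x - riesz_potential \<alpha> E z\<bar> = \<bar>\<integral>y. ?f \<alpha> x y - ?f \<alpha> z y \<partial>lborel\<bar>"
      using M' by (simp add: riesz_potential_eq[OF E(2)])
    also have "\<dots> \<le> (\<integral>y. \<bar>?f \<alpha> x y - ?f \<alpha> z y\<bar> \<partial>lborel)"
      by (rule integral_abs_bound)
    also have "\<dots> \<le> (\<integral>y. c * (?f (\<alpha> + \<beta>) x y + ?f (\<alpha> + \<beta>) z y) \<partial>lborel)"
    proof (rule integral_mono_AE)
      show "AE y in lborel. \<bar>?f \<alpha> x y - ?f \<alpha> z y\<bar> \<le> c * (?f (\<alpha> + \<beta>) x y + ?f (\<alpha> + \<beta>) z y)"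
        using AE_lborel_singleton[of x] AE_lborel_singleton[of z]
      proof eventually_elim
        case (elim y)
        have "\<bar>norm (x - y) powr - \<alpha> - norm (z - y) powr - \<alpha>\<bar> \<le> L * \<bar>norm (x - y) - norm (z - y)\<bar> powr \<beta>
            * (norm (x - y) powr - (\<alpha> + \<beta>) + norm (z - y) powr - (\<alpha> + \<beta>))"
          unfolding L_def using elim assms by (intro powr_minus_diff_le) auto
        also have "\<bar>norm (x - y) - norm (z - y)\<bar> \<le> norm (x - z)"
          using norm_triangle_ineq3[of "x - y" "z - y"] by simp
        then have "L * \<bar>norm (x - y) - norm (z - y)\<bar> powr \<beta>
            * (norm (x - y) powr - (\<alpha> + \<beta>) + norm (z - y) powr - (\<alpha> + \<beta>)) \<le>
          c * (norm (x - y) powr - (\<alpha> + \<beta>) + norm (z - y) powr - (\<alpha> + \<beta>))"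
          unfolding c_def L_def using \<beta> by (intro mult_right_mono mult_left_mono powr_mono2) auto
        finally show ?case by (simp add: indicator_def)
      qed
    qed (use M(1) M' in auto)
    also have "\<dots> = c * ((\<integral>y. ?f (\<alpha> + \<beta>) x y \<partial>lborel) + (\<integral>y. ?f (\<alpha> + \<beta>) z y \<partial>lborel))"
      using M(1) by simp
    also have "\<dots> \<le> c * (2 * max 0 M)"
      using M(2)[of x] M(2)[of z] c by (intro mult_left_mono) auto
    finally show ?thesis by (simp add: c_def mult_ac)
  qed
  then show thesis by (intro that[of "L * (2 * max 0 M)"]) (auto simp: L_def)
qed

section \<open>Comparing the potential at mirror points\<close>

text \<open>A quantitative lower bound for the difference of the kernel at mirror points. The hypothesis on
  \<open>b\<^sup>2\<close> is the one provided by \<open>norm_reflect_diff_eq\<close>; the estimate is linear in the distance \<open>\<tau>\<close>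
  to the hyperplane, even as \<open>\<tau>\<close> tends to \<open>0\<close>.\<close>

lemma powr_minus_gap:
  fixes a b d \<tau> \<alpha> D :: real
  assumes "0 < a" "0 < b" "b\<^sup>2 = a\<^sup>2 + 4 * \<tau> * d" "0 \<le> \<tau>" "0 \<le> d" "b \<le> D" "0 < \<alpha>"
  shows "2 * \<alpha> * \<tau> * d * (D powr - \<alpha> / D\<^sup>2) \<le> a powr - \<alpha> - b powr - \<alpha>"
proof -
  have "1 - a\<^sup>2 / b\<^sup>2 = (b\<^sup>2 - a\<^sup>2) / b\<^sup>2"
    using assms(2) by (simp add: diff_divide_distrib)
  also have "b\<^sup>2 - a\<^sup>2 = 4 * \<tau> * d" using assms(3) by simp
  finally have "2 * \<tau> * d / b\<^sup>2 = (1 - a\<^sup>2 / b\<^sup>2) / 2" by simp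
  also have "\<dots> \<le> - ln (a\<^sup>2 / b\<^sup>2) / 2"
    using ln_le_minus_one[of "a\<^sup>2 / b\<^sup>2"] assms(1,2) by simp
  also have "\<dots> = ln (b / a)"
    using assms(1,2) by (simp add: ln_div ln_realpow)
  finally have ln: "2 * \<tau> * d / b\<^sup>2 \<le> ln (b / a)" .
  have "1 + \<alpha> * ln (b / a) \<le> exp (\<alpha> * ln (b / a))" by (rule exp_ge_add_one_self)
  also have "\<dots> = (b / a) powr \<alpha>" using assms by (simp add: powr_def)
  finally have p: "1 + \<alpha> * (2 * \<tau> * d / b\<^sup>2) \<le> (b / a) powr \<alpha>"
    using mult_left_mono[OF ln, of \<alpha>] assms by linarith
  have "2 * \<alpha> * \<tau> * d * (D powr - \<alpha> / D\<^sup>2) \<le> 2 * \<alpha> * \<tau> * d * (b powr - \<alpha> / b\<^sup>2)"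
    using assms(1,2,4-7) by (intro mult_left_mono frac_le powr_mono2' power_mono) auto
  also have "\<dots> = b powr - \<alpha> * (1 + \<alpha> * (2 * \<tau> * d / b\<^sup>2)) - b powr - \<alpha>"
    by (simp add: algebra_simps)
  also have "\<dots> \<le> b powr - \<alpha> * (b / a) powr \<alpha> - b powr - \<alpha>"
    using p by (intro diff_right_mono mult_left_mono) auto
  also have "b powr - \<alpha> * (b / a) powr \<alpha> = a powr - \<alpha>"
    using assms by (simp add: powr_divide powr_minus field_simps)
  finally show ?thesis .
qed

text \<open>A single point with mirror image outside \<open>E\<close> could lie on a part of \<open>\<partial>E\<close> that is invisible to
  integration. As \<open>E\<close> is the interior of its closure, nearby points have mirror images in the exterior
  of \<open>E\<close>, which gives a whole ball.\<close>

lemma open_unreflected_ball: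
  fixes E :: "'a::euclidean_space set"
  assumes e: "norm e = 1" and E: "open E" "interior (closure E) \<subseteq> E"
    and y0: "y0 \<in> E" "y0 \<bullet> e < l" "reflect e l y0 \<notin> E"
  obtains z \<delta> where "0 < \<delta>"
    "\<And>y. y \<in> ball z \<delta> \<Longrightarrow> y \<in> E \<and> reflect e l y \<notin> E \<and> \<delta> \<le> l - y \<bullet> e"
proof -
  define W where "W = E \<inter> {y. y \<bullet> e < l}"
  have W: "open W" unfolding W_def using E(1) by (intro open_Int open_Collect_less continuous_intros)
  define G where "G = W \<inter> reflect e l -` (- closure E)"
  have G: "open G" unfolding G_def using W
    by (intro open_Int open_vimage continuous_on_reflect) auto
  have "G \<noteq> {}"
  proof
    assume "G = {}"
    then have "reflect e l ` W \<subseteq> closure E" by (auto simp: G_def)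
    then have "reflect e l ` W \<subseteq> interior (closure E)"
      using open_reflect_image[OF e W] by (simp add: interior_maximal)
    then show False using E(2) y0 by (auto simp: W_def)
  qed
  then obtain z r where r: "0 < r" "ball z r \<subseteq> G"
    using G unfolding open_contains_ball by blast
  show thesis
  proof (rule that[of "r/2" z])
    fix y assume y: "y \<in> ball z (r/2)"
    have "dist z (y + (r/2) *\<^sub>R e) < r"
      using dist_triangle[of z "y + (r/2) *\<^sub>R e" y] y e r by (simp add: dist_norm)
    then have "y + (r/2) *\<^sub>R e \<in> G" using r by auto
    then have "r/2 \<le> l - y \<bullet> e" using e by (simp add: G_def W_def inner_add_left norm_eq_1)
    moreover have "y \<in> G" using y r by auto
    ultimately show "y \<in> E \<and> reflect e l y \<notin> E \<and> r/2 \<le> l - y \<bullet> e"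
      using closure_subset[of E] by (auto simp: G_def W_def)
  qed (use r in simp)
qed

text \<open>The substitution of \<open>reflect e l y\<close> for \<open>y\<close> changes the sign of \<open>w x\<close>. Averaging both forms of the
  integral yields an integrand \<open>f x\<close> that has a sign when the cap folds into \<open>E\<close>: both factors change
  sign at the hyperplane.\<close>

lemma riesz_potential_reflect_diff:
  fixes E :: "(real^'n) set" and l :: real
  assumes e: "norm e = 1" and E: "open E" "bounded E" and \<alpha>: "0 < \<alpha>" "\<alpha> < real CARD('n)"
  defines "w \<equiv> \<lambda>x y. norm (x - y) powr - \<alpha> - norm (reflect e l x - y) powr - \<alpha>"
  defines "f \<equiv> \<lambda>x y. (indicator E y - indicator E (reflect e l y)) * w x y"
  shows "integrable lborel (f x)"
    and "riesz_potential \<alpha> E x - riesz_potential \<alpha> E (reflect e l x) = (1/2) * (\<integral>y. f x y \<partial>lborel)"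
proof -
  have Eb [measurable]: "E \<in> sets borel" using E by simp
  obtain M' where M': "\<And>x. integrable lborel (\<lambda>y. indicator E y * norm (x - y) powr - \<alpha>)"
    using integrable_norm_powr_uniform[of \<alpha> E] assms by auto
  define h where "h y = indicator E y * w x y" for y
  have h: "integrable lborel h" "riesz_potential \<alpha> E x - riesz_potential \<alpha> E (reflect e l x) = (\<integral>y. h y \<partial>lborel)"
  proof -
    have "h = (\<lambda>y. indicator E y * norm (x - y) powr - \<alpha>
        - indicator E y * norm (reflect e l x - y) powr - \<alpha>)"
      by (rule ext) (simp add: h_def w_def right_diff_distrib)
    then show "integrable lborel h"
        "riesz_potential \<alpha> E x - riesz_potential \<alpha> E (reflect e l x) = (\<integral>y. h y \<partial>lborel)"
      using M'[of x] M'[of "reflect e l x"] by (simp_all add: riesz_potential_eq[OF Eb])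
  qed
  have "w x (reflect e l y) = - w x y" for y
    unfolding w_def norm_reflect_reflect[OF e] by (simp add: norm_reflect_swap[OF e])
  then have f: "f x y = h y + h (reflect e l y)" for y
    by (simp add: f_def h_def algebra_simps)
  have h': "integrable lborel (\<lambda>y. h (reflect e l y))"
    using integrable_lborel_reflect[OF e h(1)] .
  show "integrable lborel (f x)"
    unfolding f[abs_def] using h(1) h' by simp
  have "(\<integral>y. f x y \<partial>lborel) = (\<integral>y. h y \<partial>lborel) + (\<integral>y. h (reflect e l y) \<partial>lborel)"
    unfolding f using h(1) h' by simp
  also have "(\<integral>y. h (reflect e l y) \<partial>lborel) = (\<integral>y. h y \<partial>lborel)"
    using borel_measurable_integrable[OF h(1)] by (intro integral_lborel_reflect[OF e]) simp
  finally show "riesz_potential \<alpha> E x - riesz_potential \<alpha> E (reflect e l x) = (1/2) * (\<integral>y. f x y \<partial>lborel)"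
    using h(2) by simp
qed

text \<open>The integrand of \<open>riesz_potential_reflect_diff\<close> is nonnegative, and on a ball of points of \<open>E\<close> without
  mirror image in \<open>E\<close> it is bounded below by a multiple of the distance \<open>l - x \<bullet> e\<close>.\<close>

lemma riesz_potential_reflect_gap:
  fixes E :: "(real^'n) set"
  assumes e: "norm e = 1" and E: "open E" "bounded E" "interior (closure E) \<subseteq> E"
    and \<alpha>: "0 < \<alpha>" "\<alpha> < real CARD('n)"
    and cap: "\<And>y. y \<in> E \<Longrightarrow> l < y \<bullet> e \<Longrightarrow> reflect e l y \<in> E"
    and y0: "y0 \<in> E" "y0 \<bullet> e < l" "reflect e l y0 \<notin> E"
  obtains c where "0 < c" "\<And>x. x \<in> closure E \<Longrightarrow> x \<bullet> e < l \<Longrightarrow>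
    c * (l - x \<bullet> e) \<le> riesz_potential \<alpha> E x - riesz_potential \<alpha> E (reflect e l x)"
proof -
  obtain z \<delta> where A: "0 < \<delta>"
    "\<And>y. y \<in> ball z \<delta> \<Longrightarrow> y \<in> E \<and> reflect e l y \<notin> E \<and> \<delta> \<le> l - y \<bullet> e"
    using open_unreflected_ball[OF e E(1,3) y0] by blast
  obtain B where B: "\<And>x. x \<in> closure E \<Longrightarrow> norm x \<le> B"
    using E(2) bounded_closure[of E] by (auto simp: bounded_iff)
  have B0: "0 \<le> B" using order_trans[OF norm_ge_zero B[of y0]] y0(1) closure_subset[of E] by blast
  \<comment> \<open>\<open>D\<close> bounds the distance of points of \<open>E\<close> from mirror images of points of \<open>closure E\<close>.\<close>
  define D where "D = 4 * B + 2 * \<bar>l\<bar> + 1"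
  have D: "0 < D" using B0 by (simp add: D_def)
  define m where "m = measure lborel (ball z \<delta>)"
  have m: "0 < m" using A(1) content_ball_pos[of \<delta> z] by (simp add: m_def)
  define \<kappa> where "\<kappa> = 2 * \<alpha> * \<delta> * (D powr - \<alpha> / D\<^sup>2)"
  have \<kappa>: "0 < \<kappa>" using A D \<alpha> by (simp add: \<kappa>_def)
  show thesis
  proof (rule that[of "\<kappa> * m / 2"])
    fix x assume x: "x \<in> closure E" "x \<bullet> e < l"
    define \<tau> where "\<tau> = l - x \<bullet> e"
    have \<tau>: "0 < \<tau>" using x by (simp add: \<tau>_def)
    define w where "w y = norm (x - y) powr - \<alpha> - norm (reflect e l x - y) powr - \<alpha>" for y
    define f where "f y = (indicator E y - indicator E (reflect e l y)) * w y" for y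
    have eq: "(norm (reflect e l x - y))\<^sup>2 = (norm (x - y))\<^sup>2 + 4 * \<tau> * (l - y \<bullet> e)" for y
      unfolding \<tau>_def by (rule norm_reflect_diff_eq[OF e])
    have pos: "\<kappa> * \<tau> * indicator (ball z \<delta>) y \<le> f y" if "y \<noteq> x" "y \<noteq> reflect e l x" for y
    proof (cases "y \<bullet> e" l rule: linorder_cases)
      case less
      have w: "2 * \<alpha> * \<tau> * (l - y \<bullet> e) * (D' powr - \<alpha> / D'\<^sup>2) \<le> w y"
        if "norm (reflect e l x - y) \<le> D'" for D'
        unfolding w_def using \<open>y \<noteq> x\<close> \<open>y \<noteq> reflect e l x\<close> less that \<alpha> \<tau>
        by (intro powr_minus_gap eq) auto
      then have "0 \<le> w y"
      proof -
        have "0 \<le> 2 * \<alpha> * \<tau> * (l - y \<bullet> e) *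
            (norm (reflect e l x - y) powr - \<alpha> / (norm (reflect e l x - y))\<^sup>2)"
          using \<tau> \<alpha> less by (intro mult_nonneg_nonneg) auto
        then show ?thesis using w[OF order_refl] by linarith
      qed
      moreover have "(indicator E (reflect e l y) :: real) \<le> indicator E y"
        using cap[of "reflect e l y"] less e by (auto simp: indicator_def reflect_inner)
      ultimately have f0: "0 \<le> f y" by (simp add: f_def)
      show ?thesis
      proof (cases "y \<in> ball z \<delta>")
        case True
        have yE: "y \<in> E" and y\<delta>: "\<delta> \<le> l - y \<bullet> e" using A(2)[OF True] by auto
        have "norm (reflect e l x - y) \<le> norm (reflect e l x - x) + norm (x - y)"
          using norm_triangle_ineq[of "reflect e l x - x" "x - y"] by simp
        also have "norm (reflect e l x - x) = \<bar>2 * (x \<bullet> e - l)\<bar>"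
          using e by (simp add: reflect_def)
        also have "\<dots> = 2 * \<bar>x \<bullet> e - l\<bar>" by (simp only: abs_mult abs_numeral)
        also have "\<bar>x \<bullet> e - l\<bar> \<le> B + \<bar>l\<bar>"
          using Cauchy_Schwarz_ineq2[of x e] e B[OF x(1)] by simp
        also have "norm (x - y) \<le> B + B"
          using norm_triangle_ineq4[of x y] B[OF x(1)] B[of y] yE closure_subset[of E] by fastforce
        finally have "norm (reflect e l x - y) \<le> D" by (simp add: D_def)
        from w[OF this] have "2 * \<alpha> * \<tau> * (l - y \<bullet> e) * (D powr - \<alpha> / D\<^sup>2) \<le> w y" .
        moreover have "2 * \<alpha> * \<tau> * \<delta> * (D powr - \<alpha> / D\<^sup>2) \<le> 2 * \<alpha> * \<tau> * (l - y \<bullet> e) * (D powr - \<alpha> / D\<^sup>2)"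
          using y\<delta> \<alpha> \<tau> by (intro mult_right_mono mult_left_mono) auto
        ultimately show ?thesis using A(2)[OF True] True
          by (simp add: f_def \<kappa>_def mult_ac)
      qed (use f0 in simp)
    next
      case equal
      have "y \<notin> ball z \<delta>" using A equal by force
      then show ?thesis using equal by (simp add: f_def reflect_on_plane)
    next
      case greater
      have "y \<notin> ball z \<delta>" using A greater by force
      moreover have "(indicator E y :: real) \<le> indicator E (reflect e l y)"
        using cap[of y] greater by (auto simp: indicator_def)
      moreover have "(norm (reflect e l x - y))\<^sup>2 \<le> (norm (x - y))\<^sup>2"
        using eq[of y] \<tau> greater mult_nonneg_nonpos[of "4 * \<tau>" "l - y \<bullet> e"] by simp
      then have "norm (reflect e l x - y) \<le> norm (x - y)" by (simp add: power2_le_iff_abs_le)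
      then have "w y \<le> 0"
        unfolding w_def using \<alpha> \<open>y \<noteq> reflect e l x\<close> by (simp add: powr_mono2')
      ultimately show ?thesis by (simp add: f_def mult_nonpos_nonpos)
    qed
    have "\<kappa> * \<tau> * m = (\<integral>y. \<kappa> * \<tau> * indicator (ball z \<delta>) y \<partial>lborel)"
      by (simp add: m_def)
    also have "\<dots> \<le> (\<integral>y. f y \<partial>lborel)"
    proof (rule integral_mono_AE)
      show "AE y in lborel. \<kappa> * \<tau> * indicator (ball z \<delta>) y \<le> f y"
        using AE_lborel_singleton[of x] AE_lborel_singleton[of "reflect e l x"]
        by eventually_elim (rule pos)
      show "integrable lborel f"
        using riesz_potential_reflect_diff(1)[OF e E(1,2) \<alpha>, of l x] by (simp add: f_def[abs_def] w_def)
      show "integrable lborel (\<lambda>y. \<kappa> * \<tau> * indicator (ball z \<delta>) y)"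
        using emeasure_bounded_finite[of "ball z \<delta>"] by (intro integrable_mult_right integrable_real_indicator) auto
    qed
    finally show "\<kappa> * m / 2 * (l - x \<bullet> e) \<le> riesz_potential \<alpha> E x - riesz_potential \<alpha> E (reflect e l x)"
      using riesz_potential_reflect_diff(2)[OF e E(1,2) \<alpha>, of x l]
      by (simp add: f_def w_def \<tau>_def mult_ac)
  qed (use \<kappa> m in simp)
qed

section \<open>Boundary charts\<close>

text \<open>The function \<open>D\<close> is the derivative of \<open>f\<close> in the direction \<open>e\<close> alone. The argument differentiates
  defining functions only along the direction in which the plane moves.\<close>

definition line_deriv_on ::
    "'a::euclidean_space set \<Rightarrow> 'a \<Rightarrow> ('a \<Rightarrow> real) \<Rightarrow> ('a \<Rightarrow> real) \<Rightarrow> bool" where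
  "line_deriv_on U e f D \<longleftrightarrow> (\<forall>z s. z + s *\<^sub>R e \<in> U \<longrightarrow>
     ((\<lambda>s. f (z + s *\<^sub>R e)) has_real_derivative D (z + s *\<^sub>R e)) (at s))"

text \<open>The function \<open>g\<close> is a local defining function of \<open>E\<close> that measures the exact distance to \<open>\<partial>E\<close> along
  the graph direction \<open>v\<close>: moving \<open>x\<close> by \<open>- g x\<close> in this direction leads to \<open>\<partial>E\<close> without any use
  of the implicit function theorem.\<close>

definition boundary_chart ::
    "'a::euclidean_space set \<Rightarrow> 'a \<Rightarrow> 'a \<Rightarrow> real \<Rightarrow> ('a \<Rightarrow> real) \<Rightarrow> bool" where
  "boundary_chart E p v r g \<longleftrightarrow> 0 < r \<and> norm v = 1 \<and> (\<forall>x s. g (x + s *\<^sub>R v) = g x + s) \<and>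
     continuous_on (ball p r) g \<and> E \<inter> ball p r = {x \<in> ball p r. g x < 0}"

lemma line_mvt:
  assumes D: "line_deriv_on (ball p r) e g D"
    and x: "x \<in> ball p d" "x + s *\<^sub>R e \<in> ball p d" and "d \<le> r" "0 < s"
  obtains \<theta> where "0 < \<theta>" "\<theta> < s" "x + \<theta> *\<^sub>R e \<in> ball p d"
    "g (x + s *\<^sub>R e) - g x = s * D (x + \<theta> *\<^sub>R e)"
proof -
  have seg: "x + \<theta> *\<^sub>R e \<in> ball p d" if "0 \<le> \<theta>" "\<theta> \<le> s" for \<theta>
  proof -
    have "(1 - \<theta> / s) *\<^sub>R x + (\<theta> / s) *\<^sub>R (x + s *\<^sub>R e) \<in> ball p d"
      using convex_ball[of p d] x that \<open>0 < s\<close> by (auto simp: convex_def)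
    moreover have "(1 - \<theta> / s) *\<^sub>R x + (\<theta> / s) *\<^sub>R (x + s *\<^sub>R e) = x + \<theta> *\<^sub>R e"
      using \<open>0 < s\<close> by (simp add: algebra_simps)
    ultimately show ?thesis by simp
  qed
  have "((\<lambda>s. g (x + s *\<^sub>R e)) has_real_derivative D (x + \<theta> *\<^sub>R e)) (at \<theta>)"
    if "0 \<le> \<theta>" "\<theta> \<le> s" for \<theta>
    using D seg[OF that] \<open>d \<le> r\<close> by (auto simp: line_deriv_on_def)
  from MVT2[OF \<open>0 < s\<close> this] obtain \<theta> where "0 < \<theta>" "\<theta> < s"
      "g (x + s *\<^sub>R e) - g (x + 0 *\<^sub>R e) = (s - 0) * D (x + \<theta> *\<^sub>R e)" by blast
  then show thesis using seg[of \<theta>] by (intro that[of \<theta>]) auto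
qed

lemma chart_mem_iff:
  assumes "boundary_chart E p v r g" "x \<in> ball p r"
  shows "x \<in> E \<longleftrightarrow> g x < 0"
  using assms unfolding boundary_chart_def by blast

lemma chart_zero_frontier:
  assumes E: "boundary_chart E p v r g" and x: "x \<in> ball p r" "g x = 0"
  shows "x \<in> frontier E"
proof -
  have "x \<in> closure E"
    unfolding closure_approachable
  proof (intro allI impI)
    fix \<epsilon> :: real assume "0 < \<epsilon>"
    define s where "s = min (\<epsilon> / 2) ((r - dist p x) / 2)"
    have s: "0 < s" "s < \<epsilon>" "s < r - dist p x" using \<open>0 < \<epsilon>\<close> x by (auto simp: s_def min_def)
    define y where "y = x + (- s) *\<^sub>R v"
    have d: "dist y x = s" using E s by (simp add: y_def dist_norm boundary_chart_def)
    then have "y \<in> ball p r" using s dist_triangle[of p y x] by (simp add: dist_commute)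
    moreover have "g y = g x + (- s)" using E unfolding y_def boundary_chart_def by blast
    ultimately have "y \<in> E \<inter> ball p r" using E x s by (simp add: boundary_chart_def)
    then show "\<exists>y\<in>E. dist y x < \<epsilon>" using d s by auto
  qed
  moreover have "x \<notin> interior E"
    using chart_mem_iff[OF E x(1)] x interior_subset[of E] by auto
  ultimately show ?thesis by (simp add: frontier_def)
qed

lemma chart_frontier_zero:
  assumes E: "boundary_chart E p v r g" "open E" and x: "x \<in> ball p r" "x \<in> frontier E"
  shows "g x = 0"
proof (rule ccontr)
  assume "g x \<noteq> 0"
  have "x \<notin> E" using x E(2) by (simp add: frontier_def interior_open)
  then have "\<not> g x < 0" using E(1) x unfolding boundary_chart_def by blast
  with \<open>g x \<noteq> 0\<close> have pos: "0 < g x" by simp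
  define W where "W = ball p r \<inter> g -` {0<..}"
  have "open W" unfolding W_def using E(1)
    by (intro continuous_open_preimage) (auto simp: boundary_chart_def)
  moreover have "x \<in> W" "W \<inter> E = {}" using pos x chart_mem_iff[OF E(1)] by (auto simp: W_def)
  moreover have "x \<in> closure E" using x by (simp add: frontier_def)
  ultimately show False using open_Int_closure_eq_empty[of W E] by blast
qed

text \<open>On one side of a graph there are exterior points arbitrarily close to each boundary point.\<close>

lemma interior_closure_of_charts:
  assumes "open E" and "\<And>p. p \<in> frontier E \<Longrightarrow> \<exists>v r g. boundary_chart E p v r g"
  shows "interior (closure E) \<subseteq> E"
proof
  fix x assume x: "x \<in> interior (closure E)"
  show "x \<in> E"
  proof (rule ccontr)
    assume "x \<notin> E"
    then have xf: "x \<in> frontier E"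
      using x interior_subset[of "closure E"] assms(1) by (auto simp: frontier_def interior_open)
    then obtain v r g where ch: "boundary_chart E x v r g" using assms(2) by blast
    then have r: "0 < r" and v: "norm v = 1" by (auto simp: boundary_chart_def)
    obtain d where d: "0 < d" "ball x d \<subseteq> closure E"
      using x by (auto simp: mem_interior)
    define s where "s = min d r / 2"
    have s: "0 < s" "s < d" "s < r" using d r by (auto simp: s_def)
    define y where "y = x + s *\<^sub>R v"
    have "dist x y = s" using s v by (simp add: y_def dist_norm)
    then have y: "y \<in> closure E" "y \<in> ball x r" using s d by auto
    have gy: "g y = s"
      using ch chart_frontier_zero[OF ch assms(1) _ xf] r by (simp add: y_def boundary_chart_def)
    then have "y \<notin> E" using chart_mem_iff[OF ch y(2)] s by simp
    then have "y \<in> frontier E" using y assms(1) by (auto simp: frontier_def interior_open)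
    then show False using chart_frontier_zero[OF ch assms(1) y(2)] gy s by simp
  qed
qed

section \<open>Almost mirror-symmetric boundary points\<close>

text \<open>The mirror image of \<open>x\<close> may miss \<open>\<partial>E\<close>, but only by so little that a \<open>\<beta>\<close>-Hoelder function does not
  see the error in comparison with the distance \<open>\<tau>\<close> of \<open>x\<close> to the hyperplane.\<close>

definition fold_touching :: "real \<Rightarrow> 'a::euclidean_space set \<Rightarrow> 'a \<Rightarrow> real \<Rightarrow> bool" where
  "fold_touching \<beta> E e l \<longleftrightarrow> (\<forall>\<epsilon>>0. \<exists>\<tau>>0. \<exists>x\<in>frontier E. \<exists>x'\<in>frontier E.
     x \<bullet> e = l - \<tau> \<and> norm (reflect e l x - x') powr \<beta> \<le> \<epsilon> * \<tau>)"

text \<open>The points \<open>x\<close> and \<open>x + (2 * \<tau>) *\<^sub>R e\<close> are mirror images with midpoint \<open>x + \<tau> *\<^sub>R e\<close>, and the value of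
  \<open>g\<close> at the second is the distance by which the mirror image of the boundary point \<open>x\<close> misses
  \<open>\<partial>E\<close>. The bounds on \<open>\<tau>\<close>, \<open>x\<close> and the midpoint are those satisfied by the points constructed in
  \<open>fold_touching_at_tangency\<close>; the one on the midpoint is of order \<open>t\<^sup>2\<close> for a \<open>C\<^bsup>2,\<gamma>\<^esup>\<close>
  boundary and then controls the derivative of \<open>g\<close> at the midpoint.\<close>

definition fold_defect_le ::
    "real \<Rightarrow> real \<Rightarrow> 'a::euclidean_space \<Rightarrow> 'a \<Rightarrow> ('a \<Rightarrow> real) \<Rightarrow> bool" where
  "fold_defect_le \<epsilon> \<beta> p e g \<longleftrightarrow> (\<exists>t0>0. \<forall>t x \<tau>.
     0 < t \<longrightarrow> t < t0 \<longrightarrow> t / 2 \<le> \<tau> \<longrightarrow> \<tau> \<le> 3 * t / 2 \<longrightarrow> g x = 0 \<longrightarrow> norm (x - p) \<le> 2 * t \<longrightarrow>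
     norm (x + \<tau> *\<^sub>R e - p) \<le> 2 * \<bar>g (p - t *\<^sub>R e)\<bar> \<longrightarrow>
     \<bar>g (x + (2 * \<tau>) *\<^sub>R e)\<bar> powr \<beta> \<le> \<epsilon> * t)"

text \<open>Start at \<open>p - t *\<^sub>R e\<close>, correct along \<open>v\<close> to a boundary point \<open>x\<close>, reflect to \<open>y\<close>, and correct along
  \<open>v\<close> to a boundary point \<open>x'\<close>. Since \<open>e\<close> is tangent at \<open>p\<close>, the first correction is \<open>o(t)\<close>, so \<open>x\<close>
  has distance comparable to \<open>t\<close> from the hyperplane although \<open>v\<close> need not be orthogonal to \<open>e\<close>.\<close>

lemma fold_touching_at_tangency:
  fixes E :: "'a::euclidean_space set"
  assumes ch: "boundary_chart E p v r g" and E: "open E" "p \<in> frontier E"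
    and e: "norm e = 1" and l: "p \<bullet> e = l"
    and D: "line_deriv_on (ball p r) e g D" "continuous_on (ball p r) D" "D p = 0"
    and \<beta>: "0 < \<beta>" "\<beta> \<le> 1"
    and small: "\<And>\<epsilon>. 0 < \<epsilon> \<Longrightarrow> fold_defect_le \<epsilon> \<beta> p e g"
  shows "fold_touching \<beta> E e l"
  unfolding fold_touching_def
proof (intro allI impI)
  fix \<epsilon> :: real assume \<epsilon>: "0 < \<epsilon>"
  have r: "0 < r" and v: "norm v = 1" and gv: "\<And>x s. g (x + s *\<^sub>R v) = g x + s"
    using ch by (auto simp: boundary_chart_def)
  have gp: "g p = 0" using chart_frontier_zero[OF ch E(1) _ E(2)] r by simp
  \<comment> \<open>The factor \<open>1/2\<close> compensates \<open>t / 2 \<le> \<tau>\<close>, and the bound \<open>1\<close> makes the second correction at most \<open>t\<close>.\<close>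
  define \<epsilon>1 where "\<epsilon>1 = min (\<epsilon> / 2) 1"
  have "0 < \<epsilon>1" using \<epsilon> by (simp add: \<epsilon>1_def)
  from small[OF this] obtain t0 where t0: "0 < t0"
    "\<And>t x \<tau>. 0 < t \<Longrightarrow> t < t0 \<Longrightarrow> t / 2 \<le> \<tau> \<Longrightarrow> \<tau> \<le> 3 * t / 2 \<Longrightarrow>
        g x = 0 \<Longrightarrow> norm (x - p) \<le> 2 * t \<Longrightarrow> norm (x + \<tau> *\<^sub>R e - p) \<le> 2 * \<bar>g (p - t *\<^sub>R e)\<bar> \<Longrightarrow>
        \<bar>g (x + (2 * \<tau>) *\<^sub>R e)\<bar> powr \<beta> \<le> \<epsilon>1 * t" 
    unfolding fold_defect_le_def by blast
  obtain d where d: "0 < d" "\<And>y. y \<in> ball p r \<Longrightarrow> dist y p < d \<Longrightarrow> \<bar>D y\<bar> < 1/2"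
    using D(2,3) r unfolding continuous_on_iff dist_real_def
    by (metis centre_in_ball diff_zero half_gt_zero_iff zero_less_one)
  \<comment> \<open>With \<open>7 * t \<le> r\<close> all points constructed below stay in the domain of the chart.\<close>
  define t where "t = min (min (t0 / 2) (d / 2)) (min (r / 7) (1 / 2))"
  have t: "0 < t" "t < t0" "t < d" "7 * t \<le> r" "t < 1"
    using t0 d r by (auto simp: t_def)
  define a where "a = g (p - t *\<^sub>R e)"
  have a: "\<bar>a\<bar> \<le> t / 2"
  proof -
    have 1: "p - t *\<^sub>R e \<in> ball p (min d r)" "p - t *\<^sub>R e + t *\<^sub>R e \<in> ball p (min d r)"
      using e t r d by (auto simp: dist_norm)
    obtain \<theta> where \<theta>: "p - t *\<^sub>R e + \<theta> *\<^sub>R e \<in> ball p (min d r)"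
        "g (p - t *\<^sub>R e + t *\<^sub>R e) - g (p - t *\<^sub>R e) = t * D (p - t *\<^sub>R e + \<theta> *\<^sub>R e)"
      using line_mvt[OF D(1) 1 _ t(1)] by auto
    have "\<bar>D (p - t *\<^sub>R e + \<theta> *\<^sub>R e)\<bar> < 1/2" using \<theta>(1) by (intro d) (auto simp: dist_commute)
    moreover have "\<bar>a\<bar> = t * \<bar>D (p - t *\<^sub>R e + \<theta> *\<^sub>R e)\<bar>"
      using arg_cong[OF \<theta>(2), of abs] t gp by (simp add: a_def abs_mult)
    ultimately show ?thesis using t by (simp add: mult_left_mono[of _ "1/2" t, simplified])
  qed
  define x where "x = p - t *\<^sub>R e + (- a) *\<^sub>R v"
  define \<tau> where "\<tau> = t + a * (v \<bullet> e)"
  have ve: "\<bar>v \<bullet> e\<bar> \<le> 1" using Cauchy_Schwarz_ineq2[of v e] v e by simp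
  have av: "\<bar>a * (v \<bullet> e)\<bar> \<le> \<bar>a\<bar>" using mult_left_mono[OF ve, of "\<bar>a\<bar>"] by (simp add: abs_mult)
  have \<tau>: "t / 2 \<le> \<tau>" "\<tau> \<le> 3 * t / 2" using av a by (auto simp: \<tau>_def)
  have gx: "g x = 0" unfolding x_def gv by (simp add: a_def)
  have nx: "norm (x - p) \<le> 2 * t"
  proof -
    have "x - p = - (t *\<^sub>R e) - a *\<^sub>R v" by (simp add: x_def)
    then have "norm (x - p) \<le> t + \<bar>a\<bar>"
      using norm_triangle_ineq4[of "- (t *\<^sub>R e)" "a *\<^sub>R v"] e v t by simp
    then show ?thesis using a t by simp
  qed
  have nz: "norm (x + \<tau> *\<^sub>R e - p) \<le> 2 * \<bar>a\<bar>"
  proof -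
    have "x + \<tau> *\<^sub>R e - p = (a * (v \<bullet> e)) *\<^sub>R e - a *\<^sub>R v"
      by (simp add: x_def \<tau>_def algebra_simps)
    then have "norm (x + \<tau> *\<^sub>R e - p) \<le> \<bar>a * (v \<bullet> e)\<bar> + \<bar>a\<bar>"
      using norm_triangle_ineq4[of "(a * (v \<bullet> e)) *\<^sub>R e" "a *\<^sub>R v"] e v by simp
    then show ?thesis using av by simp
  qed
  define y where "y = x + (2 * \<tau>) *\<^sub>R e"
  have xe: "x \<bullet> e = l - \<tau>"
    using e l by (simp add: x_def \<tau>_def inner_diff_left norm_eq_1)
  then have y: "reflect e l x = y" by (simp add: reflect_def y_def)
  have gy: "\<bar>g y\<bar> powr \<beta> \<le> \<epsilon>1 * t"
    unfolding y_def using t \<tau> gx nx nz by (intro t0) (auto simp: a_def)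
  have "\<epsilon>1 * t \<le> t" using t by (simp add: \<epsilon>1_def)
  have gy1: "\<bar>g y\<bar> \<le> t"
  proof -
    have "\<bar>g y\<bar> \<le> 1"
    proof (rule ccontr)
      assume "\<not> \<bar>g y\<bar> \<le> 1"
      then have "1 \<le> \<bar>g y\<bar> powr \<beta>" using \<beta> by (intro ge_one_powr_ge_zero) auto
      then show False using gy \<open>\<epsilon>1 * t \<le> t\<close> t by linarith
    qed
    then have "\<bar>g y\<bar> \<le> \<bar>g y\<bar> powr \<beta>"
      using \<beta> powr_mono'[of \<beta> 1 "\<bar>g y\<bar>"] by (cases "g y = 0") auto
    then show ?thesis using gy \<open>\<epsilon>1 * t \<le> t\<close> by linarith
  qed
  have ny: "norm (y - p) \<le> 5 * t"
    using norm_triangle_ineq[of "x - p" "(2 * \<tau>) *\<^sub>R e"] nx e \<tau> t by (simp add: y_def algebra_simps)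
  define x' where "x' = y + (- g y) *\<^sub>R v"
  have gx': "g x' = 0" by (simp only: x'_def gv)
  have yx': "norm (y - x') = \<bar>g y\<bar>" using v by (simp add: x'_def)
  have "norm (x' - p) \<le> 6 * t"
    using norm_triangle_ineq[of "x' - y" "y - p"] yx' ny gy1 by (simp add: norm_minus_commute)
  then have x': "x' \<in> frontier E"
    using t r by (intro chart_zero_frontier[OF ch _ gx']) (auto simp: dist_norm norm_minus_commute)
  have x: "x \<in> frontier E"
    using t r nx by (intro chart_zero_frontier[OF ch _ gx]) (auto simp: dist_norm norm_minus_commute)
  have "\<epsilon>1 * t \<le> \<epsilon> / 2 * t" using t by (intro mult_right_mono) (auto simp: \<epsilon>1_def)
  also have "\<dots> \<le> \<epsilon> * \<tau>" using \<tau> \<epsilon> mult_left_mono[of "t / 2" \<tau> \<epsilon>] by simp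
  finally have "norm (reflect e l x - x') powr \<beta> \<le> \<epsilon> * \<tau>" using gy yx' y by simp
  then show "\<exists>\<tau>>0. \<exists>x\<in>frontier E. \<exists>x'\<in>frontier E. x \<bullet> e = l - \<tau> \<and> norm (reflect e l x - x') powr \<beta> \<le> \<epsilon> * \<tau>"
    using x x' xe \<tau> t by (intro exI[of _ \<tau>] conjI bexI[of _ x] bexI[of _ x']) auto
qed

text \<open>As \<open>q * \<beta> > 1\<close>, the \<open>\<beta>\<close>-th power of a term of order \<open>t powr q\<close> is \<open>o(t)\<close>.\<close>

lemma powr_small:
  assumes "0 \<le> C" "1 < q * \<beta>" "0 < \<beta>" "0 < \<epsilon>"
  shows "\<exists>t0>0. \<forall>t b. 0 < t \<longrightarrow> t < t0 \<longrightarrow> \<bar>b\<bar> \<le> C * t powr q \<longrightarrow> \<bar>b\<bar> powr \<beta> \<le> \<epsilon> * (t::real)"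
proof -
  define \<delta> where "\<delta> = q * \<beta> - 1"
  define K where "K = C powr \<beta> + 1"
  have K: "0 < K" by (simp add: K_def add_nonneg_pos)
  define t0 where "t0 = (\<epsilon> / K) powr (1 / \<delta>)"
  have \<delta>: "0 < \<delta>" using assms by (simp add: \<delta>_def)
  have "\<bar>b\<bar> powr \<beta> \<le> \<epsilon> * t" if t: "0 < t" "t < t0" and b: "\<bar>b\<bar> \<le> C * t powr q" for t b
  proof -
    have "\<bar>b\<bar> powr \<beta> \<le> (C * t powr q) powr \<beta>" using assms b by (intro powr_mono2) auto
    also have "\<dots> = C powr \<beta> * t powr (q * \<beta>)" using assms t by (simp add: powr_mult powr_powr)
    also have "\<dots> \<le> K * t powr (q * \<beta>)" by (intro mult_right_mono) (auto simp: K_def)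
    also have "t powr (q * \<beta>) = t powr \<delta> * t"
      using t powr_add[of t \<delta> 1] by (simp add: \<delta>_def)
    also have "t powr \<delta> \<le> t0 powr \<delta>" using t \<delta> by (intro powr_mono2) auto
    then have "K * (t powr \<delta> * t) \<le> K * (t0 powr \<delta> * t)" using t K by (intro mult_left_mono mult_right_mono) auto
    also have "t0 powr \<delta> = \<epsilon> / K" using \<delta> assms K by (simp add: t0_def powr_powr)
    finally show ?thesis using K by simp
  qed
  moreover have "0 < t0" using assms K by (simp add: t0_def)
  ultimately show ?thesis by blast
qed

text \<open>By the mean value theorem the defect is \<open>2 * \<tau>\<close> times a value of \<open>D\<close> near \<open>p\<close>, where \<open>D\<close> is small.\<close>

lemma fold_defect_C1:
  assumes r: "0 < r" and e: "norm e = 1" and D: "line_deriv_on (ball p r) e g D" "continuous_on (ball p r) D" "D p = 0"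
    and \<epsilon>: "0 < \<epsilon>"
  shows "fold_defect_le \<epsilon> 1 p e g"
proof -
  obtain d where d: "0 < d" "\<And>y. y \<in> ball p r \<Longrightarrow> dist y p < d \<Longrightarrow> \<bar>D y\<bar> < \<epsilon> / 3"
    using D(2,3) r \<epsilon> unfolding continuous_on_iff dist_real_def
    by (metis centre_in_ball diff_zero divide_pos_pos zero_less_numeral)
  define \<rho> where "\<rho> = min d r"
  have "\<bar>g (x + (2 * \<tau>) *\<^sub>R e)\<bar> powr 1 \<le> \<epsilon> * t"
    if t: "0 < t" "t < \<rho> / 6" and \<tau>: "t / 2 \<le> \<tau>" "\<tau> \<le> 3 * t / 2"
      and x: "g x = 0" "norm (x - p) \<le> 2 * t" for t x \<tau>
  proof -
    have "norm (x + (2 * \<tau>) *\<^sub>R e - p) \<le> 5 * t"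
      using norm_triangle_ineq[of "x - p" "(2 * \<tau>) *\<^sub>R e"] x e \<tau> t by (simp add: algebra_simps)
    then have 1: "x \<in> ball p \<rho>" "x + (2 * \<tau>) *\<^sub>R e \<in> ball p \<rho>"
      using x t by (simp_all add: dist_norm norm_minus_commute)
    obtain \<theta> where \<theta>: "x + \<theta> *\<^sub>R e \<in> ball p \<rho>"
        "g (x + (2 * \<tau>) *\<^sub>R e) - g x = (2 * \<tau>) * D (x + \<theta> *\<^sub>R e)"
      using line_mvt[OF D(1) 1, of thesis] \<tau> t by (auto simp: \<rho>_def)
    have "\<bar>D (x + \<theta> *\<^sub>R e)\<bar> \<le> \<epsilon> / 3"
      using \<theta>(1) by (intro less_imp_le d) (auto simp: \<rho>_def dist_commute)
    then have "(2 * \<tau>) * \<bar>D (x + \<theta> *\<^sub>R e)\<bar> \<le> (3 * t) * (\<epsilon> / 3)"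
      using \<tau> t by (rule_tac mult_mono) auto
    then show ?thesis using \<theta>(2) x \<tau> t by (simp add: abs_mult mult.commute)
  qed
  moreover have "0 < \<rho> / 6" using d r by (simp add: \<rho>_def)
  ultimately show ?thesis unfolding fold_defect_le_def by blast
qed

text \<open>As in the \<open>C\<^sup>1\<close> case, but now the value of \<open>D\<close> is \<open>O(t powr \<gamma>)\<close>.\<close>

lemma fold_defect_C1_holder:
  assumes r: "0 < r" and e: "norm e = 1" and D: "line_deriv_on (ball p r) e g D" "holder_on \<gamma> (ball p r) D" "D p = 0"
    and \<gamma>: "0 < \<gamma>" and \<beta>: "1 < (1 + \<gamma>) * \<beta>" "0 < \<beta>" and \<epsilon>: "0 < \<epsilon>"
  shows "fold_defect_le \<epsilon> \<beta> p e g"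
proof -
  obtain C0 where C0: "\<And>x y. x \<in> ball p r \<Longrightarrow> y \<in> ball p r \<Longrightarrow> \<bar>D x - D y\<bar> \<le> C0 * dist x y powr \<gamma>"
    using D(2) unfolding holder_on_def by blast
  define C where "C = max 0 C0"
  have C: "0 \<le> C" "\<And>y. y \<in> ball p r \<Longrightarrow> \<bar>D y\<bar> \<le> C * dist y p powr \<gamma>"
  proof -
    fix y assume "y \<in> ball p r"
    then have "\<bar>D y\<bar> \<le> C0 * dist y p powr \<gamma>" using C0[of y p] r D(3) by simp
    also have "\<dots> \<le> C * dist y p powr \<gamma>" by (intro mult_right_mono) (auto simp: C_def)
    finally show "\<bar>D y\<bar> \<le> C * dist y p powr \<gamma>" .
  qed (simp add: C_def)
  define K where "K = 3 * C * 6 powr \<gamma>"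
  obtain t0 where t0: "0 < t0"
    "\<And>t b. 0 < t \<Longrightarrow> t < t0 \<Longrightarrow> \<bar>b\<bar> \<le> K * t powr (1 + \<gamma>) \<Longrightarrow> \<bar>b\<bar> powr \<beta> \<le> \<epsilon> * t"
    using powr_small[of K "1 + \<gamma>" \<beta> \<epsilon>] \<beta> \<epsilon> C by (auto simp: K_def)
  have "\<bar>g (x + (2 * \<tau>) *\<^sub>R e)\<bar> powr \<beta> \<le> \<epsilon> * t"
    if t: "0 < t" "t < min t0 (r / 6)" and \<tau>: "t / 2 \<le> \<tau>" "\<tau> \<le> 3 * t / 2"
      and x: "g x = 0" "norm (x - p) \<le> 2 * t" for t x \<tau>
  proof -
    have "norm (x + (2 * \<tau>) *\<^sub>R e - p) \<le> 5 * t"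
      using norm_triangle_ineq[of "x - p" "(2 * \<tau>) *\<^sub>R e"] x e \<tau> t by (simp add: algebra_simps)
    then have 1: "x \<in> ball p (6 * t)" "x + (2 * \<tau>) *\<^sub>R e \<in> ball p (6 * t)"
      using x t by (simp_all add: dist_norm norm_minus_commute)
    obtain \<theta> where \<theta>: "x + \<theta> *\<^sub>R e \<in> ball p (6 * t)"
        "g (x + (2 * \<tau>) *\<^sub>R e) - g x = (2 * \<tau>) * D (x + \<theta> *\<^sub>R e)"
      using line_mvt[OF D(1) 1, of thesis] \<tau> t by auto
    have "\<bar>D (x + \<theta> *\<^sub>R e)\<bar> \<le> C * dist (x + \<theta> *\<^sub>R e) p powr \<gamma>"
      using \<theta>(1) t by (intro C) auto
    also have "\<dots> \<le> C * (6 * t) powr \<gamma>"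
      using \<theta>(1) \<gamma> C by (intro mult_left_mono powr_mono2) (auto simp: dist_commute)
    finally have "(2 * \<tau>) * \<bar>D (x + \<theta> *\<^sub>R e)\<bar> \<le> (3 * t) * (C * (6 * t) powr \<gamma>)"
      using \<tau> t by (rule_tac mult_mono) auto
    then have "\<bar>g (x + (2 * \<tau>) *\<^sub>R e)\<bar> \<le> (3 * t) * (C * (6 * t) powr \<gamma>)"
      using \<theta>(2) x \<tau> t by (simp add: abs_mult)
    also have "\<dots> = K * t powr (1 + \<gamma>)" using t by (simp add: K_def powr_mult powr_add)
    finally show ?thesis using t by (intro t0) auto
  qed
  moreover have "0 < min t0 (r / 6)" using t0 r by simp
  ultimately show ?thesis unfolding fold_defect_le_def by blast
qed

text \<open>Let \<open>z\<close> be the midpoint. The defect is twice the odd part of \<open>g\<close> about \<open>z\<close> along \<open>e\<close>, and the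
  derivative of the latter along \<open>e\<close> is the even part of \<open>D\<close>, that is \<open>D z\<close> plus half a second
  difference of \<open>D\<close>. This difference is \<open>O(t powr (1 + \<gamma>))\<close> by the Hoelder
  continuity of \<open>D2\<close>. As for \<open>D z\<close>, note that \<open>D\<close> is of first order at \<open>p\<close>; thus the correction
  \<open>g (p - t *\<^sub>R e)\<close> and with it \<open>z - p\<close> are \<open>O(t\<^sup>2)\<close>, and so is \<open>D z\<close>.\<close>

lemma fold_defect_C2_holder:
  assumes r: "0 < r" and e: "norm e = 1" and gp: "g p = 0"
    and D: "line_deriv_on (ball p r) e g D" "D differentiable (at p)" "D p = 0"
    and D2: "line_deriv_on (ball p r) e D D2" "holder_on \<gamma> (ball p r) D2"
    and \<gamma>: "0 < \<gamma>" "\<gamma> \<le> 1" and \<beta>: "1 < (2 + \<gamma>) * \<beta>" "0 < \<beta>" and \<epsilon>: "0 < \<epsilon>"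
  shows "fold_defect_le \<epsilon> \<beta> p e g"
proof -
  obtain C0 where C0: "\<And>x y. x \<in> ball p r \<Longrightarrow> y \<in> ball p r \<Longrightarrow> \<bar>D2 x - D2 y\<bar> \<le> C0 * dist x y powr \<gamma>"
    using D2(2) unfolding holder_on_def by blast
  define C where "C = max 0 C0"
  have C: "0 \<le> C" "\<And>x y. x \<in> ball p r \<Longrightarrow> y \<in> ball p r \<Longrightarrow> \<bar>D2 x - D2 y\<bar> \<le> C * dist x y powr \<gamma>"
  proof -
    fix x y assume "x \<in> ball p r" "y \<in> ball p r"
    then have "\<bar>D2 x - D2 y\<bar> \<le> C0 * dist x y powr \<gamma>" by (rule C0)
    also have "\<dots> \<le> C * dist x y powr \<gamma>" by (intro mult_right_mono) (auto simp: C_def)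
    finally show "\<bar>D2 x - D2 y\<bar> \<le> C * dist x y powr \<gamma>" .
  qed (simp add: C_def)
  obtain L d where L: "0 < L" "0 < d" "\<And>y. norm (y - p) < d \<Longrightarrow> \<bar>D y\<bar> \<le> L * norm (y - p)"
  proof -
    obtain D' where D': "(D has_derivative D') (at p)" using D(2) by (auto simp: differentiable_def)
    obtain K where K: "0 < K" "\<And>h. norm (D' h) \<le> norm h * K"
      using bounded_linear.pos_bounded[OF has_derivative_bounded_linear[OF D']] by blast
    obtain d where d: "0 < d"
        "\<And>y. norm (y - p) < d \<Longrightarrow> norm (D y - D p - D' (y - p)) \<le> 1 * norm (y - p)"
      using D' unfolding has_derivative_at_alt by (metis zero_less_one)
    have "\<bar>D y\<bar> \<le> (K + 1) * norm (y - p)" if "norm (y - p) < d" for y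
      using d(2)[OF that] K(2)[of "y - p"] D(3) by (simp add: algebra_simps)
    then show thesis using that[of "K + 1" d] K(1) d(1) by simp
  qed
  define K where "K = 6 * L\<^sup>2 + 9 * C * 3 powr \<gamma>"
  have K: "0 \<le> K" using C by (simp add: K_def)
  obtain t0 where t0: "0 < t0"
    "\<And>t b. 0 < t \<Longrightarrow> t < t0 \<Longrightarrow> \<bar>b\<bar> \<le> K * t powr (2 + \<gamma>) \<Longrightarrow> \<bar>b\<bar> powr \<beta> \<le> \<epsilon> * t"
    using powr_small[of K "2 + \<gamma>" \<beta> \<epsilon>] \<beta> \<epsilon> K by auto
  define t1 where "t1 = min (min t0 (r / 6)) (min (d / 6) 1)"
  have "\<bar>g (x + (2 * \<tau>) *\<^sub>R e)\<bar> powr \<beta> \<le> \<epsilon> * t"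
    if t: "0 < t" "t < t1" and \<tau>: "t / 2 \<le> \<tau>" "\<tau> \<le> 3 * t / 2"
      and x: "g x = 0" "norm (x - p) \<le> 2 * t"
      and z: "norm (x + \<tau> *\<^sub>R e - p) \<le> 2 * \<bar>g (p - t *\<^sub>R e)\<bar>" for t x \<tau>
  proof -
    have tt: "t < t0" "6 * t < r" "6 * t < d" "t < 1" using t by (auto simp: t1_def)
    have a: "\<bar>g (p - t *\<^sub>R e)\<bar> \<le> L * t\<^sup>2"
    proof -
      have 1: "p - t *\<^sub>R e \<in> ball p (6 * t)" "p - t *\<^sub>R e + t *\<^sub>R e \<in> ball p (6 * t)"
        using e t by (auto simp: dist_norm)
      obtain \<theta> where \<theta>: "0 < \<theta>" "\<theta> < t"
          "g (p - t *\<^sub>R e + t *\<^sub>R e) - g (p - t *\<^sub>R e) = t * D (p - t *\<^sub>R e + \<theta> *\<^sub>R e)"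
        using line_mvt[OF D(1) 1 _ t(1)] tt by auto
      have n: "norm (p - t *\<^sub>R e + \<theta> *\<^sub>R e - p) = t - \<theta>"
      proof -
        have "p - t *\<^sub>R e + \<theta> *\<^sub>R e - p = (\<theta> - t) *\<^sub>R e" by (simp add: algebra_simps)
        then show ?thesis using \<theta> e by simp
      qed
      have "\<bar>D (p - t *\<^sub>R e + \<theta> *\<^sub>R e)\<bar> \<le> L * norm (p - t *\<^sub>R e + \<theta> *\<^sub>R e - p)"
        using n \<theta> tt t by (intro L) simp
      also have "\<dots> \<le> L * t" using n \<theta> L by simp
      finally have "t * \<bar>D (p - t *\<^sub>R e + \<theta> *\<^sub>R e)\<bar> \<le> t * (L * t)" using t by simp
      moreover have "\<bar>g (p - t *\<^sub>R e)\<bar> = t * \<bar>D (p - t *\<^sub>R e + \<theta> *\<^sub>R e)\<bar>"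
        using arg_cong[OF \<theta>(3), of abs] gp t by (simp add: abs_mult)
      ultimately show ?thesis by (simp add: power2_eq_square mult_ac)
    qed
    define z where "z = x + \<tau> *\<^sub>R e"
    have zp: "norm (z - p) \<le> 2 * (L * t\<^sup>2)" using \<open>norm (x + \<tau> *\<^sub>R e - p) \<le> _\<close> a by (simp add: z_def)
    have zp': "norm (z - p) \<le> 7 / 2 * t"
      using norm_triangle_ineq[of "x - p" "\<tau> *\<^sub>R e"] x e \<tau> t by (simp add: z_def algebra_simps)
    have zs: "norm (z + s *\<^sub>R e - p) \<le> 5 * t" if "\<bar>s\<bar> \<le> \<tau>" for s
      using norm_triangle_ineq[of "z - p" "s *\<^sub>R e"] zp' e \<tau> that by (simp add: algebra_simps)
    then have ball: "z + s *\<^sub>R e \<in> ball p r" if "\<bar>s\<bar> \<le> \<tau>" for s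
      using zs[OF that] tt t by (simp add: dist_norm norm_minus_commute)
    have \<tau>0: "0 < \<tau>" using \<tau> t by simp
    have zm: "z - s *\<^sub>R e = z + (- s) *\<^sub>R e" for s by simp
    \<comment> \<open>Used with \<open>sg = 1\<close> for the odd part of \<open>g\<close> and with \<open>sg = - 1\<close> for the even part of \<open>D\<close>.\<close>
    have der: "((\<lambda>s. f (z + s *\<^sub>R e) - sg * f (z - s *\<^sub>R e)) has_real_derivative
        f' (z + s *\<^sub>R e) + sg * f' (z - s *\<^sub>R e)) (at s)"
      if f: "line_deriv_on (ball p r) e f f'" and s: "\<bar>s\<bar> \<le> \<tau>" for f f' sg s
    proof -
      have 1: "((\<lambda>s. f (z + s *\<^sub>R e)) has_real_derivative f' (z + s *\<^sub>R e)) (at s)"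
        using f ball[OF s] by (simp add: line_deriv_on_def)
      have "((\<lambda>s. f (z + s *\<^sub>R e)) has_real_derivative f' (z + (- s) *\<^sub>R e)) (at (- s))"
        using f ball[of "- s"] s unfolding line_deriv_on_def by (metis abs_minus_cancel)
      from DERIV_chain2[where f = "\<lambda>s. f (z + s *\<^sub>R e)" and g = "\<lambda>s. - s" and x = s and s = UNIV and Db = "- 1", OF this]
      have 2: "((\<lambda>s. f (z + (- s) *\<^sub>R e)) has_real_derivative f' (z + (- s) *\<^sub>R e) * (- 1)) (at s)"
        by (simp add: DERIV_minus[OF DERIV_ident])
      show ?thesis unfolding zm
        using DERIV_diff[OF 1 DERIV_cmult[OF 2, of sg]] by simp
    qed
    obtain s where s: "0 < s" "s < \<tau>"
      "g (z + \<tau> *\<^sub>R e) - g (z - \<tau> *\<^sub>R e) = \<tau> * (D (z + s *\<^sub>R e) + D (z - s *\<^sub>R e))"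
      using MVT2[OF \<tau>0 der[OF D(1), of _ 1]] by auto
    obtain s' where s': "0 < s'" "s' < s"
      "D (z + s *\<^sub>R e) + D (z - s *\<^sub>R e) - 2 * D z = s * (D2 (z + s' *\<^sub>R e) - D2 (z - s' *\<^sub>R e))"
      using MVT2[OF s(1) der[OF D2(1), of _ "- 1"]] s by auto
    have Dz: "\<bar>D z\<bar> \<le> L * (2 * (L * t\<^sup>2))"
    proof -
      have "\<bar>D z\<bar> \<le> L * norm (z - p)" using zp' tt t by (intro L) simp
      also have "\<dots> \<le> L * (2 * (L * t\<^sup>2))" using zp L by (intro mult_left_mono) auto
      finally show ?thesis .
    qed
    have D2z: "\<bar>D2 (z + s' *\<^sub>R e) - D2 (z - s' *\<^sub>R e)\<bar> \<le> C * (3 * t) powr \<gamma>"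
    proof -
      have "\<bar>D2 (z + s' *\<^sub>R e) - D2 (z - s' *\<^sub>R e)\<bar> \<le> C * dist (z + s' *\<^sub>R e) (z - s' *\<^sub>R e) powr \<gamma>"
        using ball[of s'] ball[of "- s'"] s s' by (intro C) auto
      also have "dist (z + s' *\<^sub>R e) (z - s' *\<^sub>R e) = 2 * s'"
      proof -
        have "(z + s' *\<^sub>R e) - (z - s' *\<^sub>R e) = (2 * s') *\<^sub>R e" by (simp add: algebra_simps flip: scaleR_add_left)
        then show ?thesis using s' e by (simp only: dist_norm) simp
      qed
      also have "C * (2 * s') powr \<gamma> \<le> C * (3 * t) powr \<gamma>"
        using C \<gamma> s s' \<tau> by (intro mult_left_mono powr_mono2) auto
      finally show ?thesis .
    qed
    have t\<gamma>: "t\<^sup>2 \<le> t powr (1 + \<gamma>)"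
    proof -
      have "t\<^sup>2 = t powr 2" using t by simp
      also have "\<dots> \<le> t powr (1 + \<gamma>)" using t tt \<gamma> by (intro powr_mono') auto
      finally show ?thesis .
    qed
    have "\<bar>g (x + (2 * \<tau>) *\<^sub>R e)\<bar> = \<bar>g (z + \<tau> *\<^sub>R e) - g (z - \<tau> *\<^sub>R e)\<bar>"
    proof -
      have "x + (2 * \<tau>) *\<^sub>R e = z + \<tau> *\<^sub>R e"
        by (simp add: z_def add.assoc flip: scaleR_add_left)
      then have "g (x + (2 * \<tau>) *\<^sub>R e) = g (z + \<tau> *\<^sub>R e)" by (rule arg_cong)
      moreover have "g (z - \<tau> *\<^sub>R e) = 0" using x by (simp add: z_def)
      ultimately show ?thesis by simp
    qed
    also have "\<dots> = \<tau> * \<bar>2 * D z + s * (D2 (z + s' *\<^sub>R e) - D2 (z - s' *\<^sub>R e))\<bar>"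
    proof -
      have "D (z + s *\<^sub>R e) + D (z - s *\<^sub>R e) =
          2 * D z + s * (D2 (z + s' *\<^sub>R e) - D2 (z - s' *\<^sub>R e))"
        using s'(3) by linarith
      then show ?thesis unfolding s(3) using \<tau>0 by (simp only: abs_mult abs_of_pos)
    qed
    also have "\<dots> \<le> \<tau> * (2 * \<bar>D z\<bar> + s * \<bar>D2 (z + s' *\<^sub>R e) - D2 (z - s' *\<^sub>R e)\<bar>)"
      using \<tau>0 s abs_triangle_ineq[of "2 * D z" "s * (D2 (z + s' *\<^sub>R e) - D2 (z - s' *\<^sub>R e))"]
      by (intro mult_left_mono) (auto simp: abs_mult)
    also have "\<dots> \<le> (3 * t / 2) * (2 * (L * (2 * (L * t\<^sup>2))) + (3 * t / 2) * (C * (3 * t) powr \<gamma>))"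
    proof (rule mult_mono)
      have "s * \<bar>D2 (z + s' *\<^sub>R e) - D2 (z - s' *\<^sub>R e)\<bar> \<le> (3 * t / 2) * (C * (3 * t) powr \<gamma>)"
        using D2z s \<tau> t by (rule_tac mult_mono) auto
      then show "2 * \<bar>D z\<bar> + s * \<bar>D2 (z + s' *\<^sub>R e) - D2 (z - s' *\<^sub>R e)\<bar>
          \<le> 2 * (L * (2 * (L * t\<^sup>2))) + (3 * t / 2) * (C * (3 * t) powr \<gamma>)"
        using Dz by simp
    qed (use s \<tau> t in auto)
    also have "\<dots> = t * (6 * L\<^sup>2 * t\<^sup>2 + 9 / 4 * C * 3 powr \<gamma> * t powr (1 + \<gamma>))"
      using t by (simp add: powr_mult powr_add power2_eq_square field_simps)
    also have "\<dots> \<le> t * (6 * L\<^sup>2 * t powr (1 + \<gamma>) + 9 * C * 3 powr \<gamma> * t powr (1 + \<gamma>))"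
      using t t\<gamma> C by (intro mult_left_mono add_mono mult_right_mono) auto
    also have "\<dots> = K * t powr (2 + \<gamma>)"
      using t powr_add[of t 1 "1 + \<gamma>"] by (simp add: K_def algebra_simps)
    finally show ?thesis using t tt by (intro t0) auto
  qed
  moreover have "0 < t1" using t0 r L by (simp add: t1_def)
  ultimately show ?thesis unfolding fold_defect_le_def by blast
qed

section \<open>Moving planes\<close>

definition folds_inside :: "'a::euclidean_space set \<Rightarrow> 'a \<Rightarrow> real \<Rightarrow> bool" where
  "folds_inside E e l \<longleftrightarrow> (\<forall>y\<in>E. l < y \<bullet> e \<longrightarrow> reflect e l y \<in> E)"

text \<open>For boundary points \<open>x\<close>, \<open>x'\<close> as in \<open>fold_touching\<close>, a missing mirror image would force
  \<open>c * \<tau> \<le> u x - u (reflect e l x) = u x' - u (reflect e l x) \<le> C * \<epsilon> * \<tau>\<close> for each \<open>\<epsilon>\<close>.\<close>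

lemma symmetric_of_fold_touching:
  fixes E :: "(real^'n) set"
  assumes e: "norm e = 1" and E: "open E" "bounded E" "interior (closure E) \<subseteq> E"
    and \<alpha>: "0 < \<alpha>" and \<beta>: "0 < \<beta>" "\<beta> \<le> 1" "\<alpha> + \<beta> < real CARD('n)"
    and const: "riesz_potential \<alpha> E constant_on frontier E"
    and cap: "folds_inside E e l" and touch: "fold_touching \<beta> E e l" and y: "y \<in> E"
  shows "reflect e l y \<in> E"
proof (rule ccontr)
  assume not: "reflect e l y \<notin> E"
  then have "y \<bullet> e < l"
    using cap y reflect_on_plane[of y e l] by (cases "y \<bullet> e" l rule: linorder_cases) (auto simp: folds_inside_def)
  then obtain c where c: "0 < c" "\<And>x. x \<in> closure E \<Longrightarrow> x \<bullet> e < l \<Longrightarrow>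
      c * (l - x \<bullet> e) \<le> riesz_potential \<alpha> E x - riesz_potential \<alpha> E (reflect e l x)"
    using riesz_potential_reflect_gap[OF e E \<alpha> _ _ y _ not] \<beta> cap unfolding folds_inside_def by auto
  obtain C where C: "0 \<le> C"
    "\<And>x z. \<bar>riesz_potential \<alpha> E x - riesz_potential \<alpha> E z\<bar> \<le> C * norm (x - z) powr \<beta>"
    using riesz_potential_holder[OF E(2) _ \<alpha> \<beta>] E(1) by auto
  \<comment> \<open>Adding \<open>1\<close> covers the case \<open>C = 0\<close>.\<close>
  define \<epsilon> where "\<epsilon> = c / (2 * (C + 1))"
  have \<epsilon>: "0 < \<epsilon>" using c C by (simp add: \<epsilon>_def)
  obtain \<tau> x x' where x: "0 < \<tau>" "x \<in> frontier E" "x' \<in> frontier E" "x \<bullet> e = l - \<tau>"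
      "norm (reflect e l x - x') powr \<beta> \<le> \<epsilon> * \<tau>"
    using touch \<epsilon> unfolding fold_touching_def by blast
  have "riesz_potential \<alpha> E x = riesz_potential \<alpha> E x'"
    using const x by (auto simp: constant_on_def)
  have "c * \<tau> \<le> riesz_potential \<alpha> E x - riesz_potential \<alpha> E (reflect e l x)"
    using c(2)[of x] x by (simp add: frontier_def)
  also have "\<dots> \<le> \<bar>riesz_potential \<alpha> E (reflect e l x) - riesz_potential \<alpha> E x'\<bar>"
    using \<open>riesz_potential \<alpha> E x = riesz_potential \<alpha> E x'\<close> by simp
  also have "\<dots> \<le> C * norm (reflect e l x - x') powr \<beta>" by (rule C)
  also have "\<dots> \<le> C * (\<epsilon> * \<tau>)" using x C by (intro mult_left_mono)
  also have "\<dots> \<le> (C + 1) * (\<epsilon> * \<tau>)" using \<epsilon> x by (intro mult_right_mono) auto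
  also have "(C + 1) * (\<epsilon> * \<tau>) = ((C + 1) * \<epsilon>) * \<tau>" by simp
  also have "(C + 1) * \<epsilon> = c / 2" using C by (simp add: \<epsilon>_def field_simps)
  finally show False using c x by simp
qed

text \<open>The critical position \<open>L\<close> is the infimum of the positions down to which all caps fold into \<open>E\<close>. The
  cap at \<open>L\<close> folds into the closure of \<open>E\<close> by continuity and, being open, into its interior. Positions
  below \<open>L\<close> fail, and a limit \<open>q\<close> of witnesses of this failure is the candidate for a touching point.\<close>

lemma critical_hyperplane:
  fixes E :: "'a::euclidean_space set"
  assumes e: "norm e = 1" and E: "open E" "bounded E" "E \<noteq> {}" "interior (closure E) \<subseteq> E"
  obtains L m y q where
    "\<forall>l\<ge>L. folds_inside E e l"
    "m \<longlonglongrightarrow> L" "y \<longlonglongrightarrow> q"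
    "\<forall>k::nat. y k \<in> E \<and> m k < y k \<bullet> e \<and> reflect e (m k) (y k) \<notin> E"
proof -
  obtain B where B: "\<And>y. y \<in> E \<Longrightarrow> norm y \<le> B" using E(2) by (auto simp: bounded_iff)
  have Be: "\<bar>y \<bullet> e\<bar> \<le> B" if "y \<in> E" for y
    using Cauchy_Schwarz_ineq2[of y e] e B[OF that] by simp
  define \<Lambda> where "\<Lambda> = {l. \<forall>m>l. folds_inside E e m}"
  have "B \<in> \<Lambda>" using Be by (force simp: \<Lambda>_def folds_inside_def)
  then have ne: "\<Lambda> \<noteq> {}" by blast
  have lower: "- B \<le> l" if "l \<in> \<Lambda>" for l
  proof (rule ccontr)
    assume "\<not> - B \<le> l"
    define m where "m = (l - B) / 2"
    have m: "l < m" "m < - B" using \<open>\<not> - B \<le> l\<close> by (auto simp: m_def)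
    obtain y where y: "y \<in> E" using E(3) by blast
    have "m < y \<bullet> e" using Be[OF y] m by auto
    then have "reflect e m y \<in> E" using that m y by (auto simp: \<Lambda>_def folds_inside_def)
    from Be[OF this] Be[OF y] show False using m by (simp add: reflect_inner[OF e])
  qed
  then have bdd: "bdd_below \<Lambda>" by (auto simp: bdd_below_def)
  define L where "L = Inf \<Lambda>"
  have above: "folds_inside E e l" if less: "L < l" for l
  proof -
    obtain l' where "l' \<in> \<Lambda>" "l' < l" using cInf_lessD[OF ne, of l] less unfolding L_def by blast
    then show ?thesis by (simp add: \<Lambda>_def)
  qed
  have fold_L: "folds_inside E e L"
  proof -
    define W where "W = E \<inter> {y. L < y \<bullet> e}"
    have W: "open W"
      unfolding W_def using E(1) by (intro open_Int open_Collect_less continuous_intros)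
    have "reflect e L y \<in> closure E" if y: "y \<in> W" for y
    proof -
      have "((\<lambda>m. reflect e m y) \<longlongrightarrow> reflect e L y) (at_right L)"
        unfolding reflect_def by (intro tendsto_intros)
      moreover have "eventually (\<lambda>m. reflect e m y \<in> closure E) (at_right L)"
        using y above closure_subset[of E]
        by (auto simp: eventually_at_right_field W_def folds_inside_def intro!: exI[of _ "y \<bullet> e"])
      ultimately show ?thesis by (intro Lim_in_closed_set[of "closure E"]) auto
    qed
    then have "reflect e L ` W \<subseteq> interior (closure E)"
      using open_reflect_image[OF e W] by (intro interior_maximal) auto
    then show ?thesis using E(4) by (auto simp: folds_inside_def W_def)
  qed
  have "\<exists>m y. L - 1 / real (Suc k) < m \<and> m \<le> L \<and> y \<in> E \<and> m < y \<bullet> e \<and> reflect e m y \<notin> E" for k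
  proof -
    have "L - 1 / real (Suc k) \<notin> \<Lambda>" using cInf_lower[OF _ bdd] by (force simp: L_def)
    then obtain m where m: "L - 1 / real (Suc k) < m" "\<not> folds_inside E e m"
      by (auto simp: \<Lambda>_def)
    then have "m \<le> L" using above by force
    then show ?thesis using m by (auto simp: folds_inside_def)
  qed
  then obtain m y where my: "\<And>k. L - 1 / real (Suc k) < m k" "\<And>k. m k \<le> L" "\<And>k. y k \<in> E"
      "\<And>k. m k < y k \<bullet> e" "\<And>k. reflect e (m k) (y k) \<notin> E"
    by metis
  have "m \<longlonglongrightarrow> L"
  proof (rule tendsto_sandwich)
    show "(\<lambda>k. L - 1 / real (Suc k)) \<longlonglongrightarrow> L"
      using tendsto_diff[OF tendsto_const[of L] LIMSEQ_Suc[OF lim_1_over_n]] by simp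
    show "\<forall>\<^sub>F k in sequentially. L - 1 / real (Suc k) \<le> m k"
      using my(1) by (intro always_eventually allI less_imp_le)
  qed (use my(2) in auto)
  moreover have "compact (closure E)" using E(2) by (simp add: compact_closure)
  then obtain q s where "strict_mono (s :: nat \<Rightarrow> nat)" "(y \<circ> s) \<longlonglongrightarrow> q"
    using my(3) closure_subset[of E] unfolding compact_def by (metis subset_eq)
  ultimately show thesis
    using my above fold_L
    by (intro that[of L "m \<circ> s" "y \<circ> s" q]) (auto intro: LIMSEQ_subseq_LIMSEQ simp: le_less)
qed

text \<open>The witnesses show that \<open>g\<close> is somewhere decreasing in the direction \<open>e\<close> arbitrarily close to \<open>q\<close>, so
  \<open>D q > 0\<close> is impossible. If \<open>D q < 0\<close>, then points slightly beyond the hyperplane lie in \<open>E\<close> but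
  their mirror images do not.\<close>

lemma tangent_at_fold_limit:
  fixes E :: "'a::euclidean_space set"
  assumes e: "norm e = 1" and E: "open E"
    and ch: "boundary_chart E q v r g" "q \<in> frontier E"
    and D: "line_deriv_on (ball q r) e g D" "continuous_on (ball q r) D"
    and l: "q \<bullet> e = l" and fold: "folds_inside E e l"
    and m: "m \<longlonglongrightarrow> l" and y: "y \<longlonglongrightarrow> q"
      "\<And>k::nat. y k \<in> E \<and> m k < y k \<bullet> e \<and> reflect e (m k) (y k) \<notin> E"
  shows "D q = 0"
proof (rule ccontr)
  assume "D q \<noteq> 0"
  have r: "0 < r" using ch by (simp add: boundary_chart_def)
  have gq: "g q = 0" using chart_frontier_zero[OF ch(1) E _ ch(2)] r by simp
  obtain d0 where d0: "0 < d0" "\<And>x. x \<in> ball q r \<Longrightarrow> dist x q < d0 \<Longrightarrow> \<bar>D x - D q\<bar> < \<bar>D q\<bar>"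
    using D(2) r \<open>D q \<noteq> 0\<close> unfolding continuous_on_iff dist_real_def
    by (metis centre_in_ball zero_less_abs_iff)
  define d where "d = min d0 r"
  have d: "0 < d" "d \<le> r" "\<And>x. x \<in> ball q d \<Longrightarrow> \<bar>D x - D q\<bar> < \<bar>D q\<bar>"
    using d0 r by (auto simp: d_def dist_commute)
  show False
  proof (cases "D q < 0")
    case True
    then have neg: "D x < 0" if "x \<in> ball q d" for x using d(3)[OF that] by linarith
    define t where "t = d / 2"
    have t: "0 < t" "t < d" using d by (auto simp: t_def)
    have ball: "q \<in> ball q d" "q + t *\<^sub>R e \<in> ball q d" "q - t *\<^sub>R e \<in> ball q d"
      "(q - t *\<^sub>R e) + t *\<^sub>R e \<in> ball q d"
      using t e by (auto simp: dist_norm)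
    obtain \<theta> where "q + \<theta> *\<^sub>R e \<in> ball q d" "g (q + t *\<^sub>R e) - g q = t * D (q + \<theta> *\<^sub>R e)"
      using line_mvt[OF D(1) ball(1,2) d(2) t(1)] by blast
    then have "g (q + t *\<^sub>R e) < 0"
      using mult_pos_neg[OF t(1) neg] gq by force
    then have "q + t *\<^sub>R e \<in> E" using chart_mem_iff[OF ch(1), of "q + t *\<^sub>R e"] ball d by auto
    moreover have "(q + t *\<^sub>R e) \<bullet> e = l + t" using e l by (simp add: inner_add_left norm_eq_1)
    ultimately have "reflect e l (q + t *\<^sub>R e) \<in> E" using fold t by (simp add: folds_inside_def)
    moreover have "reflect e l (q + t *\<^sub>R e) = q - t *\<^sub>R e"
      using \<open>(q + t *\<^sub>R e) \<bullet> e = l + t\<close> by (simp add: reflect_def algebra_simps flip: scaleR_add_left)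
    ultimately have "g (q - t *\<^sub>R e) < 0"
      using chart_mem_iff[OF ch(1), of "q - t *\<^sub>R e"] ball d by auto
    moreover obtain \<theta> where "(q - t *\<^sub>R e) + \<theta> *\<^sub>R e \<in> ball q d"
        "g ((q - t *\<^sub>R e) + t *\<^sub>R e) - g (q - t *\<^sub>R e) = t * D ((q - t *\<^sub>R e) + \<theta> *\<^sub>R e)"
      using line_mvt[OF D(1) ball(3,4) d(2) t(1)] by blast
    then have "g (q - t *\<^sub>R e) > 0"
      using mult_pos_neg[OF t(1) neg] gq by force
    ultimately show False by simp
  next
    case False
    have "(\<lambda>k. reflect e (m k) (y k)) \<longlonglongrightarrow> reflect e l q"
      unfolding reflect_def by (intro tendsto_intros m y)
    then have "(\<lambda>k. reflect e (m k) (y k)) \<longlonglongrightarrow> q" using l by (simp add: reflect_on_plane)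
    then have "eventually (\<lambda>k. reflect e (m k) (y k) \<in> ball q d \<and> y k \<in> ball q d) sequentially"
      using d y(1) by (intro eventually_conj topological_tendstoD) auto
    then obtain k where k: "reflect e (m k) (y k) \<in> ball q d" "y k \<in> ball q d"
      using eventually_happens'[OF sequentially_bot] by blast
    define z where "z = reflect e (m k) (y k)"
    define s where "s = 2 * (y k \<bullet> e - m k)"
    have yk: "z + s *\<^sub>R e = y k" by (simp add: z_def s_def reflect_def)
    have s: "0 < s" using y(2) by (simp add: s_def)
    have pos: "0 < D x" if "x \<in> ball q d" for x
      using d(3)[OF that] False \<open>D q \<noteq> 0\<close> by linarith
    have "z \<in> ball q d" "z + s *\<^sub>R e \<in> ball q d" using k unfolding yk by (simp_all add: z_def)
    then obtain \<theta> where "z + \<theta> *\<^sub>R e \<in> ball q d" "g (z + s *\<^sub>R e) - g z = s * D (z + \<theta> *\<^sub>R e)"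
      using line_mvt[OF D(1) _ _ d(2) s] by blast
    then have "g z < g (y k)"
      using mult_pos_pos[OF s pos] unfolding yk by force
    moreover have "g (y k) < 0" "\<not> g z < 0"
      using chart_mem_iff[OF ch(1), of "y k"] chart_mem_iff[OF ch(1), of z] k y(2)[of k] d
      by (auto simp: z_def)
    ultimately show False by simp
  qed
qed

text \<open>What the moving plane method needs to know about the boundary near \<open>p\<close>.\<close>

definition touching_chart :: "real \<Rightarrow> 'a::euclidean_space set \<Rightarrow> 'a \<Rightarrow> 'a \<Rightarrow> bool" where
  "touching_chart \<beta> E e p \<longleftrightarrow> (\<exists>v r g D. boundary_chart E p v r g \<and>
      line_deriv_on (ball p r) e g D \<and> continuous_on (ball p r) D \<and>
      (D p = 0 \<longrightarrow> fold_touching \<beta> E e (p \<bullet> e)))"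

text \<open>Let \<open>q\<close> be the limit point at the critical position. If it is off the hyperplane, then it and its
  mirror image are both on \<open>\<partial>E\<close>; if it is on the hyperplane, then \<open>e\<close> is tangent at \<open>q\<close>. Either way
  \<open>fold_touching\<close> holds.\<close>

lemma exists_symmetry_hyperplane:
  fixes E :: "'a::euclidean_space set"
  assumes e: "norm e = 1" and E: "open E" "bounded E" "E \<noteq> {}"
    and charts: "\<And>p. p \<in> frontier E \<Longrightarrow> touching_chart \<beta> E e p"
    and symmetric: "\<And>l y. folds_inside E e l \<Longrightarrow> fold_touching \<beta> E e l \<Longrightarrow> y \<in> E \<Longrightarrow> reflect e l y \<in> E"
  obtains L where "\<And>l. L < l \<Longrightarrow> folds_inside E e l" "\<And>y. y \<in> E \<Longrightarrow> reflect e L y \<in> E"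
proof -
  have reg: "interior (closure E) \<subseteq> E" using charts unfolding touching_chart_def
    by (intro interior_closure_of_charts E) blast
  obtain L m y q where fold': "\<forall>l\<ge>L. folds_inside E e l" and m: "m \<longlonglongrightarrow> L"
    and y': "y \<longlonglongrightarrow> q" "\<forall>k::nat. y k \<in> E \<and> m k < y k \<bullet> e \<and> reflect e (m k) (y k) \<notin> E"
    by (rule critical_hyperplane[OF e E reg])
  note fold = fold'[rule_format] and y = y'(1) y'(2)[rule_format]
  have cl: "q \<in> closure E"
    using y(2) closure_subset[of E]
    by (intro Lim_in_closed_set[OF closed_closure _ _ y(1)] always_eventually) auto
  have "L \<le> q \<bullet> e"
    using y(2) by (intro LIMSEQ_le[OF m tendsto_inner[OF y(1) tendsto_const]]) (auto intro: less_imp_le)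
  have lim: "(\<lambda>k. reflect e (m k) (y k)) \<longlonglongrightarrow> reflect e L q"
    unfolding reflect_def by (intro tendsto_intros m y)
  have Rq: "reflect e L q \<notin> E"
    using Lim_in_closed_set[OF _ _ _ lim, of "- E"] E(1) y(2) by (auto intro!: always_eventually)
  have "fold_touching \<beta> E e L"
  proof (cases "q \<bullet> e = L")
    case True
    then have "q \<in> frontier E"
      using Rq cl E(1) by (simp add: reflect_on_plane frontier_def interior_open)
    then obtain v r g D where "boundary_chart E q v r g" "line_deriv_on (ball q r) e g D"
        "continuous_on (ball q r) D" "D q = 0 \<longrightarrow> fold_touching \<beta> E e (q \<bullet> e)"
      using charts unfolding touching_chart_def by blast
    moreover from this have "D q = 0"
      using tangent_at_fold_limit[OF e E(1) _ \<open>q \<in> frontier E\<close> _ _ True fold m y] by blast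
    ultimately show ?thesis using True by simp
  next
    case False
    then have q: "L < q \<bullet> e" using \<open>L \<le> q \<bullet> e\<close> by simp
    have "q \<notin> E" using Rq fold[of L] q by (auto simp: folds_inside_def)
    have "(\<lambda>k. reflect e L (y k)) \<longlonglongrightarrow> reflect e L q"
      unfolding reflect_def by (intro tendsto_intros y)
    moreover have "eventually (\<lambda>k. L < y k \<bullet> e) sequentially"
      using order_tendstoD(1)[OF tendsto_inner[OF y(1) tendsto_const] q] .
    then have "eventually (\<lambda>k. reflect e L (y k) \<in> closure E) sequentially"
      by eventually_elim (use y(2) fold[of L] closure_subset[of E] in \<open>auto simp: folds_inside_def\<close>)
    ultimately have "reflect e L q \<in> closure E"
      by (intro Lim_in_closed_set[OF closed_closure]) auto
    then have fr: "reflect e L q \<in> frontier E" "q \<in> frontier E"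
      using Rq cl \<open>q \<notin> E\<close> E(1) by (auto simp: frontier_def interior_open)
    show ?thesis
      unfolding fold_touching_def
    proof (intro allI impI)
      fix \<epsilon> :: real assume "0 < \<epsilon>"
      show "\<exists>\<tau>>0. \<exists>x\<in>frontier E. \<exists>x'\<in>frontier E.
          x \<bullet> e = L - \<tau> \<and> norm (reflect e L x - x') powr \<beta> \<le> \<epsilon> * \<tau>"
        using fr q e \<open>0 < \<epsilon>\<close>
        by (intro exI[of _ "q \<bullet> e - L"] conjI bexI[of _ "reflect e L q"] bexI[of _ q])
          (auto simp: reflect_inner)
    qed
  qed
  then show thesis using fold symmetric by (intro that[of L]) auto
qed

section \<open>Balls\<close>

text \<open>If \<open>y\<close> is closer to \<open>c\<close> than \<open>x \<in> E\<close>, then the bisecting hyperplane of \<open>x\<close> and \<open>y\<close> separates \<open>x\<close>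
  from \<open>c\<close>, and folding along it takes \<open>x\<close> to \<open>y\<close>.\<close>

lemma ball_of_central_folds:
  fixes E :: "'a::euclidean_space set"
  assumes E: "open E" "bounded E" "E \<noteq> {}"
    and fold: "\<And>e l. norm e = 1 \<Longrightarrow> c \<bullet> e < l \<Longrightarrow> folds_inside E e l"
  shows "\<exists>r>0. E = ball c r"
proof -
  have star: "y \<in> E" if x: "x \<in> E" and less: "dist c y < dist c x" for x y
  proof -
    define e where "e = (x - y) /\<^sub>R norm (x - y)"
    define l where "l = ((x + y) /\<^sub>R 2) \<bullet> e"
    have xy: "0 < norm (x - y)" using less by auto
    have e: "norm e = 1" using xy by (simp add: e_def)
    have xye: "(x - y) \<bullet> e = norm (x - y)"
      using xy by (simp add: e_def power2_norm_eq_inner[symmetric] power2_eq_square)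
    have xl: "x \<bullet> e - l = norm (x - y) / 2"
      using xye by (simp add: l_def inner_add_left inner_diff_left field_simps)
    have "(norm (c - x))\<^sup>2 - (norm (c - y))\<^sup>2 = (x + y - 2 *\<^sub>R c) \<bullet> (x - y)"
      by (simp add: power2_norm_eq_inner inner_diff_left inner_diff_right inner_add_left inner_commute algebra_simps)
    also have "\<dots> = 2 * (l - c \<bullet> e) * norm (x - y)"
    proof -
      have "x - y = norm (x - y) *\<^sub>R e" using xy by (simp add: e_def)
      then have "(x + y - 2 *\<^sub>R c) \<bullet> (x - y) = norm (x - y) * ((x + y - 2 *\<^sub>R c) \<bullet> e)"
        by (metis inner_scaleR_right)
      then show ?thesis by (simp add: l_def inner_diff_left algebra_simps)
    qed
    finally have "(norm (c - x))\<^sup>2 - (norm (c - y))\<^sup>2 = 2 * (l - c \<bullet> e) * norm (x - y)" .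
    moreover have "(norm (c - y))\<^sup>2 < (norm (c - x))\<^sup>2"
      using less by (simp add: dist_norm power_strict_mono)
    ultimately have "0 < 2 * (l - c \<bullet> e) * norm (x - y)" by linarith
    then have "c \<bullet> e < l" using xy by (simp add: zero_less_mult_iff)
    moreover have "l < x \<bullet> e" using xl xy by linarith
    ultimately have "reflect e l x \<in> E" using fold[OF e] x by (auto simp: folds_inside_def)
    moreover have "reflect e l x = y"
    proof -
      have "reflect e l x = x - norm (x - y) *\<^sub>R e" using xl by (simp add: reflect_def)
      also have "norm (x - y) *\<^sub>R e = x - y" using xy by (simp add: e_def)
      finally show ?thesis by simp
    qed
    ultimately show "y \<in> E" by simp
  qed
  define r where "r = (SUP x\<in>E. dist c x)"
  have bdd: "bdd_above (dist c ` E)"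
    using bounded_any_center[of E c] E(2) by (auto simp: bdd_above_def)
  have "E = ball c r"
  proof (intro subset_antisym subsetI)
    fix y assume y: "y \<in> E"
    obtain d where d: "0 < d" "ball y d \<subseteq> E" using E(1) y unfolding open_contains_ball by blast
    show "y \<in> ball c r"
    proof -
      obtain u where u: "norm u = 1" "y - c = norm (y - c) *\<^sub>R u"
      proof (cases "y = c")
        case True
        obtain b :: 'a where "b \<in> Basis" using nonempty_Basis by blast
        then show thesis using True by (intro that[of b]) auto
      next
        case False
        then show thesis by (intro that[of "(y - c) /\<^sub>R norm (y - c)"]) auto
      qed
      define x where "x = y + (d / 2) *\<^sub>R u"
      have "dist y x = d / 2" using u d by (simp add: x_def dist_norm)
      then have x: "x \<in> E" using d by auto
      have "x - c = (y - c) + (d / 2) *\<^sub>R u" by (simp add: x_def)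
      also have "\<dots> = (norm (y - c) + d / 2) *\<^sub>R u"
        by (subst u(2)) (simp only: scaleR_add_left)
      finally have "norm (x - c) = norm (y - c) + d / 2" using u(1) d by simp
      then have "dist c y < dist c x" using d by (simp add: dist_norm norm_minus_commute)
      then show ?thesis using cSUP_upper[OF x bdd] by (simp add: r_def)
    qed
  next
    fix y assume "y \<in> ball c r"
    then obtain x where "x \<in> E" "dist c y < dist c x"
      using less_cSUP_iff[OF E(3) bdd] by (auto simp: r_def)
    then show "y \<in> E" by (rule star)
  qed
  moreover have "0 < r" using E(3) \<open>E = ball c r\<close> by auto
  ultimately show ?thesis by blast
qed

definition centroid :: "'a::euclidean_space set \<Rightarrow> 'a" where
  "centroid E = (\<integral>y. indicator E y *\<^sub>R y \<partial>lborel) /\<^sub>R measure lborel E"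

lemma centroid_on_symmetry_hyperplane:
  fixes E :: "'a::euclidean_space set"
  assumes e: "norm e = 1" and E: "open E" "bounded E" "E \<noteq> {}"
    and sym: "\<And>y. y \<in> E \<Longrightarrow> reflect e l y \<in> E"
  shows "centroid E \<bullet> e = l"
proof -
  have [measurable]: "E \<in> sets borel" using E by simp
  obtain B where B: "\<And>y. y \<in> E \<Longrightarrow> norm y \<le> B" using E(2) by (auto simp: bounded_iff)
  have fin: "emeasure lborel E < \<infinity>" using emeasure_bounded_finite[OF E(2)] .
  have int: "integrable lborel (\<lambda>y. indicator E y *\<^sub>R y)"
  proof (rule Bochner_Integration.integrable_bound)
    show "integrable lborel (\<lambda>y. B * indicator E y)"
      using fin by (intro integrable_mult_right integrable_real_indicator) auto
  qed (use B in \<open>auto simp: indicator_def intro!: AE_I2 order_trans[OF B]\<close>)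
  have int1: "integrable lborel (indicator E :: 'a \<Rightarrow> real)"
    using fin by (intro integrable_real_indicator) auto
  \<comment> \<open>The signed distance to the hyperplane is odd under the reflection, so its integral over \<open>E\<close> vanishes.\<close>
  define f where "f y = indicator E y * (y \<bullet> e - l)" for y
  have f: "f = (\<lambda>y. (indicator E y *\<^sub>R y) \<bullet> e - l * indicator E y)"
    by (rule ext) (simp add: f_def algebra_simps)
  have fm: "f \<in> borel_measurable borel" unfolding f_def by measurable
  have "f (reflect e l y) = - f y" for y
    using sym[of y] sym[of "reflect e l y"] e
    by (auto simp: f_def reflect_inner indicator_def)
  then have "(\<integral>y. f y \<partial>lborel) = - (\<integral>y. f y \<partial>lborel)"
    using integral_lborel_reflect[OF e fm, of l] by simp
  then have "0 = (\<integral>y. f y \<partial>lborel)" by simp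
  also have "\<dots> = (\<integral>y. indicator E y *\<^sub>R y \<partial>lborel) \<bullet> e - l * measure lborel E"
  proof -
    have "(\<integral>y. f y \<partial>lborel) = (\<integral>y. (indicator E y *\<^sub>R y) \<bullet> e \<partial>lborel) - (\<integral>y. l * indicator E y \<partial>lborel)"
      unfolding f
      by (intro Bochner_Integration.integral_diff integrable_inner_left integrable_mult_right int int1)
    also have "(\<integral>y. (indicator E y *\<^sub>R y) \<bullet> e \<partial>lborel) = (\<integral>y. indicator E y *\<^sub>R y \<partial>lborel) \<bullet> e"
      by (rule integral_inner_left) (rule int)
    finally show ?thesis by simp
  qed
  finally have "(\<integral>y. indicator E y *\<^sub>R y \<partial>lborel) \<bullet> e = l * measure lborel E" by simp
  moreover have "0 < measure lborel E"
  proof -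
    have "E \<notin> null_sets lborel"
      using open_not_negligible[OF E(1,3)] by (auto simp: negligible_iff_null_sets null_sets_completionI)
    then have "emeasure lborel E \<noteq> 0" by auto
    then show ?thesis using fin by (simp add: measure_def enn2real_positive_iff zero_less_iff_neq_zero)
  qed
  ultimately show ?thesis by (simp add: centroid_def)
qed

section \<open>Defining functions of subgraphs\<close>

lemma holder_on_sum:
  assumes "finite B" "\<And>b. b \<in> B \<Longrightarrow> holder_on \<gamma> U (f b)"
  shows "holder_on \<gamma> U (\<lambda>x. \<Sum>b\<in>B. c b * f b x)"
proof -
  obtain C where C: "\<And>b x y. b \<in> B \<Longrightarrow> x \<in> U \<Longrightarrow> y \<in> U \<Longrightarrow> \<bar>f b x - f b y\<bar> \<le> C b * dist x y powr \<gamma>"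
    using assms(2) unfolding holder_on_def by metis
  have "\<bar>(\<Sum>b\<in>B. c b * f b x) - (\<Sum>b\<in>B. c b * f b y)\<bar> \<le> (\<Sum>b\<in>B. \<bar>c b\<bar> * C b) * dist x y powr \<gamma>"
    if "x \<in> U" "y \<in> U" for x y
  proof -
    have "\<bar>(\<Sum>b\<in>B. c b * f b x) - (\<Sum>b\<in>B. c b * f b y)\<bar> = \<bar>\<Sum>b\<in>B. c b * (f b x - f b y)\<bar>"
      by (simp add: sum_subtractf right_diff_distrib)
    also have "\<dots> \<le> (\<Sum>b\<in>B. \<bar>c b * (f b x - f b y)\<bar>)" by (rule sum_abs)
    also have "\<dots> \<le> (\<Sum>b\<in>B. \<bar>c b\<bar> * (C b * dist x y powr \<gamma>))"
      using C that by (intro sum_mono) (auto simp: abs_mult intro!: mult_left_mono)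
    also have "\<dots> = (\<Sum>b\<in>B. \<bar>c b\<bar> * C b) * dist x y powr \<gamma>"
      by (simp add: sum_distrib_right mult.assoc)
    finally show ?thesis .
  qed
  then show ?thesis unfolding holder_on_def by blast
qed

lemma holder_on_const_minus:
  assumes "holder_on \<gamma> U f"
  shows "holder_on \<gamma> U (\<lambda>x. k - f x)"
  using assms by (simp add: holder_on_def abs_minus_commute)

lemma holder_on_imp_continuous_on:
  assumes f: "holder_on \<gamma> U f" and \<gamma>: "0 < \<gamma>"
  shows "continuous_on U f"
  unfolding continuous_on_def
proof
  fix x assume x: "x \<in> U"
  obtain C where C: "\<And>x y. x \<in> U \<Longrightarrow> y \<in> U \<Longrightarrow> \<bar>f x - f y\<bar> \<le> C * dist x y powr \<gamma>"
    using f unfolding holder_on_def by blast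
  have "((\<lambda>y. dist y x) \<longlongrightarrow> dist x x) (at x within U)" by (intro tendsto_intros)
  then have "((\<lambda>y. dist y x) \<longlongrightarrow> 0) (at x within U)" by simp
  then have "((\<lambda>y. dist y x powr \<gamma>) \<longlongrightarrow> 0 powr \<gamma>) (at x within U)"
    using \<gamma> by (intro tendsto_powr') auto
  from tendsto_mult[OF tendsto_const[of C] this]
  have lim: "((\<lambda>y. C * dist y x powr \<gamma>) \<longlongrightarrow> 0) (at x within U)" by simp
  have "((\<lambda>y. f y - f x) \<longlongrightarrow> 0) (at x within U)"
  proof (rule Lim_null_comparison[OF _ lim])
    show "\<forall>\<^sub>F y in at x within U. norm (f y - f x) \<le> C * dist y x powr \<gamma>"
      using C x by (auto simp: eventually_at_filter)
  qed
  then show "(f \<longlongrightarrow> f x) (at x within U)" using Lim_null by blast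
qed

text \<open>The coordinates \<open>T (x - p)\<close> of \<open>boundary_of_class\<close>; \<open>pullback_deriv e f\<close> is the derivative of
  \<open>f (T (x - p))\<close> in the direction \<open>e\<close>, expressed by the partial derivatives of \<open>f\<close>.\<close>

locale rotated_ball =
  fixes T :: "'a::euclidean_space \<Rightarrow> 'a" and p :: 'a and r :: real
  assumes T: "orthogonal_transformation T"
begin

lemma line_T: "T (z + s *\<^sub>R e - p) = T (z - p) + s *\<^sub>R T e"
proof -
  interpret linear T using T by (rule orthogonal_transformation_linear)
  show ?thesis by (simp add: diff add scale)
qed

lemma T_0: "T 0 = 0"
  using T by (intro linear_0 orthogonal_transformation_linear)

lemma T_diff: "T (x - y) = T x - T y"
  using T by (intro linear_diff orthogonal_transformation_linear)

lemma norm_T: "norm (T x) = norm x"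
  using T by (rule orthogonal_transformation_norm)

lemma T_mem_ball: "T (x - p) \<in> ball 0 r \<longleftrightarrow> x \<in> ball p r"
  by (simp add: norm_T dist_norm norm_minus_commute)

lemma holder_on_pullback:
  assumes "holder_on \<gamma> (ball 0 r) f"
  shows "holder_on \<gamma> (ball p r) (\<lambda>x. f (T (x - p)))"
proof -
  have "dist (T (x - p)) (T (y - p)) = dist x y" for x y
    by (simp add: dist_norm norm_T flip: T_diff)
  then show ?thesis
    using assms unfolding holder_on_def by (metis T_mem_ball)
qed

lemma continuous_on_pullback:
  assumes "continuous_on (ball 0 r) f"
  shows "continuous_on (ball p r) (\<lambda>x. f (T (x - p)))"
proof (rule continuous_on_compose2[OF assms])
  have "bounded_linear T"
    using T by (simp add: orthogonal_transformation_linear flip: linear_conv_bounded_linear)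
  then show "continuous_on (ball p r) (\<lambda>x. T (x - p))"
    by (rule bounded_linear.continuous_on) (intro continuous_intros)
qed (use T_mem_ball in blast)

definition pullback_deriv where
  "pullback_deriv e f w = (\<Sum>b\<in>Basis. (T e \<bullet> b) * frechet_derivative f (at w) b)"

lemma line_deriv_on_pullback:
  assumes f: "\<And>w. w \<in> ball 0 r \<Longrightarrow> f differentiable (at w)"
  shows "line_deriv_on (ball p r) e (\<lambda>x. f (T (x - p))) (\<lambda>x. pullback_deriv e f (T (x - p)))"
  unfolding line_deriv_on_def
proof (intro allI impI)
  fix z s assume "z + s *\<^sub>R e \<in> ball p r"
  then have w: "T (z + s *\<^sub>R e - p) \<in> ball 0 r" by (simp only: T_mem_ball)
  let ?f' = "frechet_derivative f (at (T (z - p) + s *\<^sub>R T e))"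
  have fd: "(f has_derivative ?f') (at (T (z - p) + s *\<^sub>R T e))"
    using f[OF w] unfolding line_T frechet_derivative_works .
  have "((\<lambda>s. T (z - p) + s *\<^sub>R T e) has_derivative (\<lambda>h. h *\<^sub>R T e)) (at s)"
    by (auto intro!: derivative_eq_intros)
  from has_derivative_compose[OF this fd]
  have "((\<lambda>s. f (T (z - p) + s *\<^sub>R T e)) has_derivative (\<lambda>h. ?f' (h *\<^sub>R T e))) (at s)" .
  moreover have "?f' (h *\<^sub>R T e) = pullback_deriv e f (T (z - p) + s *\<^sub>R T e) * h" for h
  proof -
    interpret linear ?f' using fd by (rule has_derivative_linear)
    have "?f' (T e) = ?f' (\<Sum>b\<in>Basis. (T e \<bullet> b) *\<^sub>R b)" by (simp add: euclidean_representation)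
    also have "\<dots> = pullback_deriv e f (T (z - p) + s *\<^sub>R T e)"
      by (simp add: sum scale pullback_deriv_def)
    finally show ?thesis by (simp add: scale)
  qed
  ultimately show "((\<lambda>s. f (T (z + s *\<^sub>R e - p))) has_real_derivative
      pullback_deriv e f (T (z + s *\<^sub>R e - p))) (at s)"
    by (simp add: has_field_derivative_def line_T)
qed

end

locale graph_chart = rotated_ball T p r
  for T :: "real^'n \<Rightarrow> real^'n" and p r +
  fixes E :: "(real^'n) set" and i :: 'n and \<phi> :: "real^'n \<Rightarrow> real"
  assumes r: "0 < r"
    and indep: "\<And>y z. (\<forall>j. j \<noteq> i \<longrightarrow> y $ j = z $ j) \<Longrightarrow> \<phi> y = \<phi> z"
    and \<phi>_diff: "\<And>w. w \<in> ball 0 r \<Longrightarrow> \<phi> differentiable (at w)"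
    and subgraph: "E \<inter> ball p r = {x \<in> ball p r. T (x - p) $ i < \<phi> (T (x - p))}"
begin

definition height where "height x = T (x - p) $ i - \<phi> (T (x - p))"

definition slope where "slope e x = T e $ i - pullback_deriv e \<phi> (T (x - p))"

text \<open>The graph direction in the original coordinates is the preimage of the \<open>i\<close>-th axis under \<open>T\<close>. Since
  \<open>\<phi>\<close> does not depend on the \<open>i\<close>-th coordinate, \<open>height\<close> grows with unit speed in this direction.\<close>

lemma boundary_chart_height: "\<exists>v. boundary_chart E p v r height"
proof -
  obtain v where v: "T v = axis i 1"
    using orthogonal_transformation_surj[OF T] by (metis surjD)
  have "norm v = 1" using norm_T[of v] v by (simp add: norm_axis_1)
  moreover have "height (x + s *\<^sub>R v) = height x + s" for x s
  proof -
    have T_eq: "T (x + s *\<^sub>R v - p) = T (x - p) + s *\<^sub>R axis i 1"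
      using line_T[of x s v] v by simp
    have "\<phi> (T (x - p) + s *\<^sub>R axis i 1) = \<phi> (T (x - p))"
      by (rule indep) (simp add: axis_def)
    then show ?thesis unfolding height_def T_eq by (simp add: axis_def)
  qed
  moreover have "continuous_on (ball p r) height"
  proof -
    have "continuous_on (ball 0 r) \<phi>"
      using \<phi>_diff by (intro differentiable_imp_continuous_on differentiable_at_imp_differentiable_on)
    then have "continuous_on (ball 0 r) (\<lambda>w. w $ i - \<phi> w)" by (intro continuous_intros)
    from continuous_on_pullback[OF this] show ?thesis by (simp add: height_def[abs_def])
  qed
  moreover have "E \<inter> ball p r = {x \<in> ball p r. height x < 0}"
    using subgraph by (auto simp: height_def)
  ultimately show ?thesis using r unfolding boundary_chart_def by blast
qed

lemma line_deriv_on_height: "line_deriv_on (ball p r) e height (slope e)"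
  unfolding line_deriv_on_def
proof (intro allI impI)
  fix z s assume zs: "z + s *\<^sub>R e \<in> ball p r"
  have lin: "T (z + s *\<^sub>R e - p) $ i = T (z - p) $ i + s * (T e $ i)" for s
    by (simp add: line_T)
  have "((\<lambda>s. T (z + s *\<^sub>R e - p) $ i) has_real_derivative T e $ i) (at s)"
    unfolding lin by (auto intro!: derivative_eq_intros)
  then show "((\<lambda>s. height (z + s *\<^sub>R e)) has_real_derivative slope e (z + s *\<^sub>R e)) (at s)"
    unfolding height_def slope_def using line_deriv_on_pullback[OF \<phi>_diff, of e] zs
    by (intro DERIV_diff) (auto simp: line_deriv_on_def)
qed

lemma slope_continuous_on:
  assumes "\<And>b. b \<in> Basis \<Longrightarrow> continuous_on (ball 0 r) (\<lambda>w. frechet_derivative \<phi> (at w) b)"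
  shows "continuous_on (ball p r) (slope e)"
proof -
  have "continuous_on (ball 0 r) (\<lambda>w. T e $ i - pullback_deriv e \<phi> w)"
    unfolding pullback_deriv_def by (intro continuous_intros assms)
  from continuous_on_pullback[OF this] show ?thesis by (simp add: slope_def[abs_def])
qed

lemma slope_holder_on:
  assumes "\<And>b. b \<in> Basis \<Longrightarrow> holder_on \<gamma> (ball 0 r) (\<lambda>w. frechet_derivative \<phi> (at w) b)"
  shows "holder_on \<gamma> (ball p r) (slope e)"
proof -
  have "holder_on \<gamma> (ball 0 r) (\<lambda>w. T e $ i - pullback_deriv e \<phi> w)"
    unfolding pullback_deriv_def by (intro holder_on_const_minus holder_on_sum finite_Basis assms)
  from holder_on_pullback[OF this] show ?thesis by (simp add: slope_def[abs_def])
qed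

lemma slope_differentiable:
  assumes d1: "\<And>b w. b \<in> Basis \<Longrightarrow> w \<in> ball 0 r \<Longrightarrow>
      (\<lambda>w. frechet_derivative \<phi> (at w) b) differentiable (at w)"
    and d2: "\<And>b b'. b \<in> Basis \<Longrightarrow> b' \<in> Basis \<Longrightarrow> holder_on \<gamma> (ball 0 r)
      (\<lambda>w. frechet_derivative (\<lambda>w. frechet_derivative \<phi> (at w) b) (at w) b')"
  shows "slope e differentiable (at p)" and "continuous_on (ball p r) (slope e)"
    and "\<exists>D2. line_deriv_on (ball p r) e (slope e) D2 \<and> holder_on \<gamma> (ball p r) D2"
proof -
  define F where "F b w = frechet_derivative \<phi> (at w) b" for b w
  have F: "F b differentiable (at w)" if "b \<in> Basis" "w \<in> ball 0 r" for b w
    using d1[OF that] by (simp add: F_def[abs_def])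
  show "continuous_on (ball p r) (slope e)"
    by (intro slope_continuous_on differentiable_imp_continuous_on differentiable_at_imp_differentiable_on d1)
  have De: "slope e = (\<lambda>x. T e $ i - (\<Sum>b\<in>Basis. (T e \<bullet> b) * F b (T (x - p))))"
    by (rule ext) (simp add: slope_def pullback_deriv_def F_def)
  have Tp: "T (p - p) = 0" by (simp add: T_0)
  have "T differentiable (at (p - p))"
    using T by (intro linear_imp_differentiable orthogonal_transformation_linear)
  then have dT: "(\<lambda>x. T (x - p)) differentiable (at p)"
    by (rule differentiable_compose[of T "\<lambda>x. x - p"]) (intro derivative_intros)
  have "(\<lambda>x. F b (T (x - p))) differentiable (at p)" if "b \<in> Basis" for b
  proof (rule differentiable_compose[of "F b" "\<lambda>x. T (x - p)", OF _ dT])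
    show "F b differentiable (at (T (p - p)))" unfolding Tp using that r by (intro F) auto
  qed
  then show "slope e differentiable (at p)"
    unfolding De by (intro differentiable_diff differentiable_sum differentiable_mult
        differentiable_const finite_Basis ballI)
  define D2 where "D2 x = 0 - (\<Sum>b\<in>Basis. (T e \<bullet> b) * pullback_deriv e (F b) (T (x - p)))" for x
  have "line_deriv_on (ball p r) e (slope e) D2"
    unfolding line_deriv_on_def
  proof (intro allI impI)
    fix z s assume zs: "z + s *\<^sub>R e \<in> ball p r"
    have "((\<lambda>s. F b (T (z + s *\<^sub>R e - p))) has_real_derivative pullback_deriv e (F b) (T (z + s *\<^sub>R e - p))) (at s)"
      if "b \<in> Basis" for b
      using line_deriv_on_pullback[OF F[OF that], of e] zs by (auto simp: line_deriv_on_def)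
    then show "((\<lambda>s. slope e (z + s *\<^sub>R e)) has_real_derivative D2 (z + s *\<^sub>R e)) (at s)"
      unfolding De D2_def by (intro DERIV_diff DERIV_const DERIV_sum DERIV_cmult)
  qed
  moreover have "holder_on \<gamma> (ball p r) D2"
  proof -
    have "holder_on \<gamma> (ball 0 r) (\<lambda>w. frechet_derivative (F b) (at w) b')" if "b \<in> Basis" "b' \<in> Basis" for b b'
      using d2[OF that] by (simp add: F_def[abs_def])
    then have "holder_on \<gamma> (ball 0 r) (\<lambda>w. 0 - (\<Sum>b\<in>Basis. (T e \<bullet> b) * pullback_deriv e (F b) w))"
      unfolding pullback_deriv_def by (intro holder_on_const_minus holder_on_sum finite_Basis)
    from holder_on_pullback[OF this] show ?thesis by (simp only: D2_def[abs_def])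
  qed
  ultimately show "\<exists>D2. line_deriv_on (ball p r) e (slope e) D2 \<and> holder_on \<gamma> (ball p r) D2" by blast
qed

end

section \<open>The characterization of balls\<close>

lemma boundary_graph_chart:
  fixes E :: "(real^'n) set"
  assumes bd: "boundary_of_class R E" and p: "p \<in> frontier E"
    and diff: "\<And>r \<phi>. R (ball 0 r) \<phi> \<Longrightarrow> \<forall>w\<in>ball 0 r. \<phi> differentiable (at w)"
  obtains T i r \<phi> where "graph_chart T p r E i \<phi>" "R (ball 0 r) \<phi>"
proof -
  have "\<exists>T i r \<phi>. orthogonal_transformation T \<and> 0 < r \<and>
        (\<forall>y z. (\<forall>j. j \<noteq> i \<longrightarrow> y $ j = z $ j) \<longrightarrow> \<phi> y = \<phi> z) \<and> R (ball 0 r) \<phi> \<and>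
        E \<inter> ball p r = {x \<in> ball p r. T (x - p) $ i < \<phi> (T (x - p))}"
    using bd p unfolding boundary_of_class_def by (rule bspec)
  then obtain T i r \<phi> where *: "orthogonal_transformation T" "0 < r"
      "\<forall>y z. (\<forall>j. j \<noteq> i \<longrightarrow> y $ j = z $ j) \<longrightarrow> \<phi> y = \<phi> z" "R (ball 0 r) \<phi>"
      "E \<inter> ball p r = {x \<in> ball p r. T (x - p) $ i < \<phi> (T (x - p))}"
    by (elim exE conjE)
  have "graph_chart T p r E i \<phi>"
  proof unfold_locales
    show "\<phi> y = \<phi> z" if "\<forall>j. j \<noteq> i \<longrightarrow> y $ j = z $ j" for y z
      using *(3) that by blast
    show "\<phi> differentiable (at w)" if "w \<in> ball 0 r" for w
      using diff[OF *(4)] that by blast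
  qed (rule *)+
  then show thesis using *(4) by (rule that)
qed

lemma touching_chart_C1:
  fixes E :: "(real^'n) set"
  assumes bd: "boundary_of_class (Ck_on 1) E" and E: "open E" and p: "p \<in> frontier E" and e: "norm e = 1"
  shows "touching_chart 1 E e p"
proof -
  obtain T i r \<phi> where chart': "graph_chart T p r E i \<phi>" and \<phi>: "Ck_on 1 (ball 0 r) \<phi>"
    by (rule boundary_graph_chart[OF bd p]) (simp_all add: Ck_on_def)
  interpret graph_chart T p r E i \<phi> by (rule chart')
  obtain v where ch: "boundary_chart E p v r height" using boundary_chart_height by blast
  have cont: "continuous_on (ball p r) (slope e)" using \<phi> by (intro slope_continuous_on) (simp add: Ck_on_def)
  have "fold_touching 1 E e (p \<bullet> e)" if "slope e p = 0"
    by (rule fold_touching_at_tangency[OF ch E p e refl line_deriv_on_height cont that])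
      (simp_all add: fold_defect_C1[OF r e line_deriv_on_height cont that])
  then show ?thesis using ch line_deriv_on_height cont unfolding touching_chart_def by blast
qed

lemma touching_chart_C1_holder:
  fixes E :: "(real^'n) set"
  assumes bd: "boundary_of_class (Ck_holder_on 1 \<gamma>) E" and E: "open E" and p: "p \<in> frontier E"
    and e: "norm e = 1" and \<gamma>: "0 < \<gamma>" and \<beta>: "0 < \<beta>" "\<beta> \<le> 1" "1 < (1 + \<gamma>) * \<beta>"
  shows "touching_chart \<beta> E e p"
proof -
  obtain T i r \<phi> where chart': "graph_chart T p r E i \<phi>" and \<phi>: "Ck_holder_on 1 \<gamma> (ball 0 r) \<phi>"
    by (rule boundary_graph_chart[OF bd p]) (simp_all add: Ck_holder_on_def)
  interpret graph_chart T p r E i \<phi> by (rule chart')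
  obtain v where ch: "boundary_chart E p v r height" using boundary_chart_height by blast
  have holder: "holder_on \<gamma> (ball p r) (slope e)" using \<phi> by (intro slope_holder_on) (simp add: Ck_holder_on_def)
  have cont: "continuous_on (ball p r) (slope e)" using holder \<gamma> by (rule holder_on_imp_continuous_on)
  have "fold_touching \<beta> E e (p \<bullet> e)" if "slope e p = 0"
    by (rule fold_touching_at_tangency[OF ch E p e refl line_deriv_on_height cont that \<beta>(1,2)])
      (rule fold_defect_C1_holder[OF r e line_deriv_on_height holder that \<gamma> \<beta>(3,1)])
  then show ?thesis using ch line_deriv_on_height cont unfolding touching_chart_def by blast
qed

lemma touching_chart_C2_holder:
  fixes E :: "(real^'n) set"
  assumes bd: "boundary_of_class (Ck_holder_on 2 \<gamma>) E" and E: "open E" and p: "p \<in> frontier E"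
    and e: "norm e = 1" and \<gamma>: "0 < \<gamma>" "\<gamma> \<le> 1" and \<beta>: "0 < \<beta>" "\<beta> \<le> 1" "1 < (2 + \<gamma>) * \<beta>"
  shows "touching_chart \<beta> E e p"
proof -
  obtain T i r \<phi> where chart': "graph_chart T p r E i \<phi>" and \<phi>: "Ck_holder_on 2 \<gamma> (ball 0 r) \<phi>"
    by (rule boundary_graph_chart[OF bd p]) (simp_all add: Ck_holder_on_def numeral_2_eq_2)
  interpret graph_chart T p r E i \<phi> by (rule chart')
  obtain v where ch: "boundary_chart E p v r height" using boundary_chart_height by blast
  have second: "slope e differentiable (at p)" "continuous_on (ball p r) (slope e)"
      "\<exists>D2. line_deriv_on (ball p r) e (slope e) D2 \<and> holder_on \<gamma> (ball p r) D2"
    using slope_differentiable[of \<gamma> e] \<phi> by (simp_all add: Ck_holder_on_def numeral_2_eq_2)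
  then obtain D2 where D2: "line_deriv_on (ball p r) e (slope e) D2" "holder_on \<gamma> (ball p r) D2"
    by blast
  have gp: "height p = 0" using chart_frontier_zero[OF ch E _ p] r by simp
  have "fold_touching \<beta> E e (p \<bullet> e)" if "slope e p = 0"
    by (rule fold_touching_at_tangency[OF ch E p e refl line_deriv_on_height second(2) that \<beta>(1,2)])
      (rule fold_defect_C2_holder[OF r e gp line_deriv_on_height second(1) that D2 \<gamma> \<beta>(3,1)])
  then show ?thesis using ch line_deriv_on_height second(2) unfolding touching_chart_def by blast
qed

text \<open>The condition on \<open>q\<close> leaves room for \<open>\<beta>\<close> strictly between \<open>1 / q\<close> and \<open>n - \<alpha>\<close>, an interval
  contained in \<open>(0, 1]\<close> because \<open>n - 1 \<le> \<alpha>\<close>.\<close>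

lemma exists_holder_exponent:
  fixes \<alpha> n q :: real
  assumes "n - 1 \<le> \<alpha>" "\<alpha> < n" "1 / (n - \<alpha>) < q"
  obtains \<beta> where "0 < \<beta>" "\<beta> \<le> 1" "\<alpha> + \<beta> < n" "1 < q * \<beta>"
proof -
  have q: "0 < q" using assms by (auto intro: less_trans[rotated])
  then have "1 / q < n - \<alpha>" using assms by (simp add: field_simps)
  then obtain \<beta> where \<beta>: "1 / q < \<beta>" "\<beta> < n - \<alpha>" using dense by blast
  have "0 < 1 / q" using q by simp
  then have "0 < \<beta>" using \<beta>(1) by linarith
  moreover have "1 < q * \<beta>" using \<beta>(1) q by (simp add: field_simps)
  ultimately show thesis using assms \<beta>(2) by (intro that[of \<beta>]) auto
qed

theorem theorem1p3:
  fixes E :: "(real^'n) set" and \<alpha> :: real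
  assumes dim: "CARD('n) \<ge> 2"
    and alpha: "0 < \<alpha>" "\<alpha> < real CARD('n) - 1/3"
    and domain: "open E" "connected E" "E \<noteq> {}" "bounded E"
    and reg1: "\<alpha> < real CARD('n) - 1 \<Longrightarrow> boundary_of_class (Ck_on 1) E"
    and reg2: "real CARD('n) - 1 \<le> \<alpha> \<Longrightarrow> \<alpha> < real CARD('n) - 1/2 \<Longrightarrow>
      \<exists>\<gamma>. 0 < \<gamma> \<and> \<gamma> \<le> 1 \<and> 1 + \<gamma> > 1 / (real CARD('n) - \<alpha>) \<and> boundary_of_class (Ck_holder_on 1 \<gamma>) E"
    and reg3: "real CARD('n) - 1/2 \<le> \<alpha> \<Longrightarrow> \<alpha> < real CARD('n) - 1/3 \<Longrightarrow>
      \<exists>\<gamma>. 0 < \<gamma> \<and> \<gamma> \<le> 1 \<and> 2 + \<gamma> > 1 / (real CARD('n) - \<alpha>) \<and> boundary_of_class (Ck_holder_on 2 \<gamma>) E"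
    and const: "riesz_potential \<alpha> E constant_on frontier E"
  shows "\<exists>c r. 0 < r \<and> E = ball c r"
proof -
  obtain \<beta> where \<beta>: "0 < \<beta>" "\<beta> \<le> 1" "\<alpha> + \<beta> < real CARD('n)"
    and charts: "\<And>e p. norm e = 1 \<Longrightarrow> p \<in> frontier E \<Longrightarrow> touching_chart \<beta> E e p"
  proof -
    consider "\<alpha> < real CARD('n) - 1" | "real CARD('n) - 1 \<le> \<alpha>" "\<alpha> < real CARD('n) - 1/2"
      | "real CARD('n) - 1/2 \<le> \<alpha>" by linarith
    then show thesis
    proof cases
      case 1
      then show thesis using touching_chart_C1[OF reg1 domain(1)] by (intro that[of 1]) auto
    next
      case 2
      then obtain \<gamma> where \<gamma>: "0 < \<gamma>" "1 / (real CARD('n) - \<alpha>) < 1 + \<gamma>"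
        "boundary_of_class (Ck_holder_on 1 \<gamma>) E" using reg2 by blast
      obtain \<beta> where \<beta>: "0 < \<beta>" "\<beta> \<le> 1" "\<alpha> + \<beta> < real CARD('n)" "1 < (1 + \<gamma>) * \<beta>"
        using exists_holder_exponent[OF 2(1) _ \<gamma>(2)] alpha by auto
      show thesis using \<beta> touching_chart_C1_holder[OF \<gamma>(3) domain(1) _ _ \<gamma>(1)] by (intro that[of \<beta>]) auto
    next
      case 3
      then obtain \<gamma> where \<gamma>: "0 < \<gamma>" "\<gamma> \<le> 1" "1 / (real CARD('n) - \<alpha>) < 2 + \<gamma>"
        "boundary_of_class (Ck_holder_on 2 \<gamma>) E" using reg3 alpha by blast
      obtain \<beta> where \<beta>: "0 < \<beta>" "\<beta> \<le> 1" "\<alpha> + \<beta> < real CARD('n)" "1 < (2 + \<gamma>) * \<beta>"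
        using exists_holder_exponent[OF _ _ \<gamma>(3)] 3 alpha by auto
      show thesis using \<beta> touching_chart_C2_holder[OF \<gamma>(4) domain(1) _ _ \<gamma>(1,2)] by (intro that[of \<beta>]) auto
    qed
  qed
  have "interior (closure E) \<subseteq> E"
  proof (rule interior_closure_of_charts[OF domain(1)])
    fix p assume "p \<in> frontier E"
    then show "\<exists>v r g. boundary_chart E p v r g"
      using charts[of "axis undefined 1" p] by (auto simp: touching_chart_def norm_axis_1)
  qed
  note symmetric = symmetric_of_fold_touching[OF _ domain(1,4) this alpha(1) \<beta> const]
  have "folds_inside E e l" if e: "norm e = 1" and l: "centroid E \<bullet> e < l" for e l
  proof -
    obtain L where L: "\<And>l. L < l \<Longrightarrow> folds_inside E e l" "\<And>y. y \<in> E \<Longrightarrow> reflect e L y \<in> E"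
      using exists_symmetry_hyperplane[OF e domain(1,4,3) charts[OF e] symmetric[OF e]]
      by blast
    have "centroid E \<bullet> e = L"
      using L(2) by (rule centroid_on_symmetry_hyperplane[OF e domain(1,4,3)])
    then show ?thesis using L(1) l by simp
  qed
  then show ?thesis using ball_of_central_folds[OF domain(1,4,3)] by blast
qed

end
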